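(* Let $\lambda,\mu$ be arbitrary strict partitions and let $x_1,x_2,x_3,\ldots$ be commuting variables. Then, as polynomial identities in the $x_i$, $$\left( \sum_{k \in \mathcal W^B(\mu,\lambda)} x_k \right) \sum_{D \in \mathcal E^B(\lambda/\mu)} \ \prod_{(i,i) \in D} x_i \prod_{\substack{(i,j) \in D \\ i < j}} (x_i + x_j) = \sum_{\mu \lessdot \nu \subseteq \lambda} \ \sum_{D \in \mathcal E^B(\lambda/\nu)} \ \prod_{(i,i) \in D} x_i \prod_{\substack{(i,j) \in D \\ i < j}} (x_i + x_j)$$ and $$\left( \sum_{k \in \mathcal W^D(\mu,\lambda)} x_k \right) \sum_{D \in \mathcal E^D(\lambda/\mu)} \ \prod_{(i,j) \in D} (x_i + x_j) = \sum_{\mu \lessdot \nu \subseteq \lambda} \ \sum_{D \in \mathcal E^D(\lambda/\nu)} \ \prod_{(i,j) \in D} (x_i + x_j),$$ where the outer sums on the right-hand sides run over all strict partitions $\nu$ that cover $\mu$ and are contained in $\lambda$.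
   Context: A strict partition is a strictly decreasing finite (possibly empty) sequence $\lambda=(\lambda_1,\ldots,\lambda_\ell)$ of positive integers; $\ell(\lambda)=\ell$ is its length, $|\lambda|=\lambda_1+\cdots+\lambda_\ell$ its size, and $\lambda_i=0$ for $i>\ell(\lambda)$. Its shifted diagrams of types B and D are $$[\lambda]^B=\{(i,j): 1\le i\le \ell(\lambda),\ i\le j\le \lambda_i+i-1\},\qquad [\lambda]^D=\{(i,j): 1\le i\le \ell(\lambda),\ i< j\le \lambda_i+i\}$$ ($i$ is the row, $j$ the column). $\mu\subseteq\lambda$ means $[\mu]^B\subseteq[\lambda]^B$ (equivalently $[\mu]^D\subseteq[\lambda]^D$). For strict partitions, $\mu\lessdot\nu$ ($\nu$ covers $\mu$) means $\mu\subseteq\nu$ and $|\nu|-|\mu|=1$. For every strict partition $\lambda$, and in both types, $\lambda'_i$ ($i\ge1$) denotes the number of cells in column $i$ of $[\lambda]^B$. Excited diagrams of type B: for $D\subseteq[\lambda]^B$, if $(i,j)\in D$, $(i+1,j+1)\in[\lambda]^B$, and none of $(i+1,j),(i,j+1),(i+1,j+1)$ is in $D$, then replacing $D$ by $(D\setminus\{(i,j)\})\cup\{(i+1,j+1)\}$ is an excited move of type B (with respect to $\lambda$). $\mathcal E^B(\lambda/\mu)$ is the set of all subsets of $[\lambda]^B$ obtainable from $[\mu]^B$ by a (possibly empty) series of excited moves of type B; it is empty if $\mu\not\subseteq\lambda$. Excited diagrams of type D: for $D\subseteq[\lambda]^D$, an excited move of type D is either (a) for $(i,j)\in D$ with $i+1<j$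 and $(i+1,j),(i,j+1),(i+1,j+1)\in[\lambda]^D\setminus D$, the replacement of $D$ by $(D\setminus\{(i,j)\})\cup\{(i+1,j+1)\}$; or (b) for $(i,i+1)\in D$ with $(i,i+2),(i,i+3),(i+1,i+2),(i+1,i+3),(i+2,i+3)\in[\lambda]^D\setminus D$, the replacement of $D$ by $(D\setminus\{(i,i+1)\})\cup\{(i+2,i+3)\}$. $\mathcal E^D(\lambda/\mu)$ is the set of all subsets of $[\lambda]^D$ obtainable from $[\mu]^D$ by a (possibly empty) series of excited moves of type D; it is empty if $\mu\not\subseteq\lambda$. $\mathcal W^B(\mu,\lambda)$ is the (finite) set of positive integers $k$ such that either $k\le\ell(\lambda)$ and $\lambda_k\ne\mu_i$ for all $i$, or $k\ge\ell(\lambda)+1$ and $\lambda'_k-k\neq\mu'_i-i$ for all $i\ge1$. $\mathcal W^D(\mu,\lambda)$ is the (finite) set consisting of: all $k\le\ell(\lambda)$ with $\lambda_k\ne\mu_i$ for all $i$; the integer $\ell(\lambda)+1$ if $\ell(\lambda)-\ell(\mu)$ is odd; and all $k\ge\ell(\lambda)+2$ with $\lambda'_{k-1}-(k-1)\neq\mu'_i-i$ for all $i\ge1$. *)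

theory Defs
  imports Main "HOL-Library.Poly_Mapping"
begin

definition strict_partition :: "nat list \<Rightarrow> bool" where
  "strict_partition lam \<longleftrightarrow> sorted_wrt (>) lam \<and> (\<forall>p\<in>set lam. p > 0)"

text \<open>Parts are indexed from 1, and parts beyond the length are 0.\<close>

definition strict_part :: "nat list \<Rightarrow> nat \<Rightarrow> nat" where
  "strict_part lam i = (if 1 \<le> i \<and> i \<le> length lam then lam ! (i - 1) else 0)"

text \<open>The subtraction in \<open>diagram_B\<close> never truncates, because \<open>i \<ge> 1\<close>.\<close>

definition diagram_B :: "nat list \<Rightarrow> (nat \<times> nat) set" where
  "diagram_B lam = {(i, j). 1 \<le> i \<and> i \<le> length lam \<and> i \<le> j \<and> j \<le> strict_part lam i + i - 1}"

definition diagram_D :: "nat list \<Rightarrow> (nat \<times> nat) set" where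
  "diagram_D lam = {(i, j). 1 \<le> i \<and> i \<le> length lam \<and> i < j \<and> j \<le> strict_part lam i + i}"

definition subshape :: "nat list \<Rightarrow> nat list \<Rightarrow> bool" where
  "subshape mu lam \<longleftrightarrow> diagram_B mu \<subseteq> diagram_B lam"

definition covered_by :: "nat list \<Rightarrow> nat list \<Rightarrow> bool" where
  "covered_by mu nu \<longleftrightarrow> subshape mu nu \<and> sum_list nu = sum_list mu + 1"

text \<open>Column lengths are those of the type B diagram in both types.\<close>

definition col_len :: "nat list \<Rightarrow> nat \<Rightarrow> nat" where
  "col_len lam j = card {i. (i, j) \<in> diagram_B lam}"

definition excited_move_B :: "nat list \<Rightarrow> (nat \<times> nat) set \<Rightarrow> (nat \<times> nat) set \<Rightarrow> bool" where
  "excited_move_B lam D D' \<longleftrightarrow> D \<subseteq> diagram_B lam \<and>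
     (\<exists>i j. (i, j) \<in> D \<and> (i + 1, j + 1) \<in> diagram_B lam \<and>
        (i + 1, j) \<notin> D \<and> (i, j + 1) \<notin> D \<and> (i + 1, j + 1) \<notin> D \<and>
        D' = (D - {(i, j)}) \<union> {(i + 1, j + 1)})"

definition excited_move_D :: "nat list \<Rightarrow> (nat \<times> nat) set \<Rightarrow> (nat \<times> nat) set \<Rightarrow> bool" where
  "excited_move_D lam D D' \<longleftrightarrow> D \<subseteq> diagram_D lam \<and>
     ((\<exists>i j. (i, j) \<in> D \<and> i + 1 < j \<and>
         {(i + 1, j), (i, j + 1), (i + 1, j + 1)} \<subseteq> diagram_D lam - D \<and>
         D' = (D - {(i, j)}) \<union> {(i + 1, j + 1)}) \<or>
      (\<exists>i. (i, i + 1) \<in> D \<and>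
         {(i, i + 2), (i, i + 3), (i + 1, i + 2), (i + 1, i + 3), (i + 2, i + 3)}
           \<subseteq> diagram_D lam - D \<and>
         D' = (D - {(i, i + 1)}) \<union> {(i + 2, i + 3)}))"

text \<open>\<open>excited_B lam mu\<close> and \<open>excited_D lam mu\<close> are the sets of excited diagrams of the
  skew shape \<open>lam / mu\<close>.\<close>

definition excited_B :: "nat list \<Rightarrow> nat list \<Rightarrow> (nat \<times> nat) set set" where
  "excited_B lam mu =
     (if subshape mu lam then {D. (excited_move_B lam)\<^sup>*\<^sup>* (diagram_B mu) D} else {})"

definition excited_D :: "nat list \<Rightarrow> nat list \<Rightarrow> (nat \<times> nat) set set" where
  "excited_D lam mu =
     (if subshape mu lam then {D. (excited_move_D lam)\<^sup>*\<^sup>* (diagram_D mu) D} else {})"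

definition W_B :: "nat list \<Rightarrow> nat list \<Rightarrow> nat set" where
  "W_B mu lam =
     {k. 1 \<le> k \<and> k \<le> length lam \<and> (\<forall>i\<ge>1. strict_part lam k \<noteq> strict_part mu i)} \<union>
     {k. k \<ge> length lam + 1 \<and>
         (\<forall>i\<ge>1. int (col_len lam k) - int k \<noteq> int (col_len mu i) - int i)}"

definition W_D :: "nat list \<Rightarrow> nat list \<Rightarrow> nat set" where
  "W_D mu lam =
     {k. 1 \<le> k \<and> k \<le> length lam \<and> (\<forall>i\<ge>1. strict_part lam k \<noteq> strict_part mu i)} \<union>
     {k. k = length lam + 1 \<and> odd (int (length lam) - int (length mu))} \<union>
     {k. k \<ge> length lam + 2 \<and>
         (\<forall>i\<ge>1. int (col_len lam (k - 1)) - int (k - 1) \<noteq> int (col_len mu i) - int i)}"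

text \<open>Polynomials over the integers in variables indexed by the natural numbers: a monomial is a
  finitely supported exponent vector, and a polynomial is a finitely supported coefficient
  function on monomials. Multiplication on \<open>poly_mapping\<close> is convolution.\<close>

type_synonym int_mpoly = "(nat \<Rightarrow>\<^sub>0 nat) \<Rightarrow>\<^sub>0 int"

definition Xvar :: "nat \<Rightarrow> int_mpoly" where
  "Xvar i = Poly_Mapping.single (Poly_Mapping.single i 1) 1"

definition weight_B :: "(nat \<times> nat) set \<Rightarrow> int_mpoly" where
  "weight_B D = (\<Prod>i | (i, i) \<in> D. Xvar i) * (\<Prod>(i, j) | (i, j) \<in> D \<and> i < j. Xvar i + Xvar j)"

definition weight_D :: "(nat \<times> nat) set \<Rightarrow> int_mpoly" where
  "weight_D D = (\<Prod>(i, j) \<in> D. Xvar i + Xvar j)"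

text \<open>Every index set of a sum or product below is finite, so no sum or product takes its
  default value.\<close>

lemma finite_diagram_B: "finite (diagram_B lam)"
proof -
  have "diagram_B lam \<subseteq> (SIGMA i:{..length lam}. {..strict_part lam i + i})"
    by (auto simp: diagram_B_def)
  then show ?thesis by (rule finite_subset) auto
qed

lemma finite_diagram_D: "finite (diagram_D lam)"
proof -
  have "diagram_D lam \<subseteq> (SIGMA i:{..length lam}. {..strict_part lam i + i})"
    by (auto simp: diagram_D_def)
  then show ?thesis by (rule finite_subset) auto
qed

lemma subshape_imp_diagram_D:
  assumes "subshape mu lam" shows "diagram_D mu \<subseteq> diagram_D lam"
proof
  fix c assume "c \<in> diagram_D mu"
  then obtain i j where c: "c = (i, Suc j)" "(i, j) \<in> diagram_B mu"
    by (cases c; cases "snd c") (auto simp: diagram_D_def diagram_B_def)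
  with assms have "(i, j) \<in> diagram_B lam" by (auto simp: subshape_def)
  with c show "c \<in> diagram_D lam" by (auto simp: diagram_D_def diagram_B_def)
qed

lemma excited_B_subset:
  assumes "D \<in> excited_B lam mu" shows "D \<subseteq> diagram_B lam"
proof -
  from assms have "subshape mu lam" and "(excited_move_B lam)\<^sup>*\<^sup>* (diagram_B mu) D"
    by (auto simp: excited_B_def split: if_splits)
  from this(2,1) show ?thesis
    by (induction rule: rtranclp_induct) (auto simp: subshape_def excited_move_B_def)
qed

lemma excited_D_subset:
  assumes "D \<in> excited_D lam mu" shows "D \<subseteq> diagram_D lam"
proof -
  from assms have "subshape mu lam" and "(excited_move_D lam)\<^sup>*\<^sup>* (diagram_D mu) D"
    by (auto simp: excited_D_def split: if_splits)
  from this(2,1) show ?thesis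
  proof (induction rule: rtranclp_induct)
    case base then show ?case by (rule subshape_imp_diagram_D)
  next
    case (step D D') then show ?case by (auto simp: excited_move_D_def)
  qed
qed

lemma finite_excited_B: "finite (excited_B lam mu)"
  by (rule finite_subset[of _ "Pow (diagram_B lam)"])
    (auto dest: excited_B_subset simp: finite_diagram_B)

lemma finite_excited_D: "finite (excited_D lam mu)"
  by (rule finite_subset[of _ "Pow (diagram_D lam)"])
    (auto dest: excited_D_subset simp: finite_diagram_D)

lemma col_len_eventually_0: "\<exists>N. \<forall>k>N. col_len lam k = 0"
proof -
  have "finite (snd ` diagram_B lam)" by (simp add: finite_diagram_B)
  then obtain N where "\<forall>k\<in>snd ` diagram_B lam. k \<le> N"
    using finite_nat_set_iff_bounded_le by auto
  then have "\<forall>k>N. {i. (i, k) \<in> diagram_B lam} = {}" by force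
  then show ?thesis unfolding col_len_def by (metis card.empty)
qed

lemma finite_W_B: "finite (W_B mu lam)"
proof -
  obtain M N where M: "\<forall>k>M. col_len lam k = 0" and N: "\<forall>k>N. col_len mu k = 0"
    using col_len_eventually_0 by metis
  have "k \<le> length lam + M + N" if "k \<in> W_B mu lam" for k
  proof (rule ccontr)
    assume "\<not> k \<le> length lam + M + N"
    moreover from this have "int (col_len lam k) - int k = int (col_len mu k) - int k"
      using M N by simp
    moreover have "1 \<le> k" using calculation(1) by simp
    ultimately show False using that unfolding W_B_def by fastforce
  qed
  then show ?thesis unfolding finite_nat_set_iff_bounded_le by blast
qed

lemma finite_W_D: "finite (W_D mu lam)"
proof -
  obtain M N where M: "\<forall>k>M. col_len lam k = 0" and N: "\<forall>k>N. col_len mu k = 0"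
    using col_len_eventually_0 by metis
  have "k \<le> length lam + M + N + 1" if "k \<in> W_D mu lam" for k
  proof (rule ccontr)
    assume a: "\<not> k \<le> length lam + M + N + 1"
    then have "int (col_len lam (k - 1)) - int (k - 1) = int (col_len mu (k - 1)) - int (k - 1)"
      using M N by simp
    moreover have "k - 1 \<ge> 1" using a by simp
    ultimately show False using that a by (auto simp: W_D_def)
  qed
  then show ?thesis unfolding finite_nat_set_iff_bounded_le by blast
qed

lemma finite_covers: "finite {nu. strict_partition nu \<and> covered_by mu nu \<and> subshape nu lam}"
proof (rule finite_subset)
  let ?n = "sum_list mu + 1"
  show "finite {xs. set xs \<subseteq> {..?n} \<and> length xs \<le> ?n}"
    by (rule finite_lists_length_le) simp
  show "{nu. strict_partition nu \<and> covered_by mu nu \<and> subshape nu lam}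
      \<subseteq> {xs. set xs \<subseteq> {..?n} \<and> length xs \<le> ?n}"
  proof clarify
    fix nu assume nu: "strict_partition nu" "covered_by mu nu"
    have "length xs \<le> sum_list xs" if "\<forall>p\<in>set xs. p > 0" for xs :: "nat list"
      using that by (induction xs) auto
    from this[of nu] nu have "length nu \<le> ?n"
      by (auto simp: strict_partition_def covered_by_def)
    moreover have "set nu \<subseteq> {..?n}"
      using nu member_le_sum_list[of _ nu] by (auto simp: covered_by_def)
    ultimately show "set nu \<subseteq> {..?n} \<and> length nu \<le> ?n" by simp
  qed
qed

end

theory Submission
  imports Defs "HOL-Combinatorics.Transposition"
begin

text \<open>
  Read the cells of \<open>lam\<close> in an order in which it grows one corner at a time, and let each cell act on
  strict partitions by adding a cell of its content (in type D, diagonal cells also remember the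
  parity of their row). The excited diagrams of \<open>lam / mu\<close> are exactly the subwords that build
  \<open>mu\<close>: excited moves commute letters past each other, and conversely a cell of \<open>mu\<close> can be slid down
  its diagonal. Splitting off the last cell \<open>c\<close> of \<open>lam\<close> therefore gives the recursion
  \<open>F mu lam = F mu lam' + wt c * F mu' lam'\<close>, where the primes remove a corner of the content of \<open>c\<close>
  (the second term is absent if \<open>mu\<close> has none).

  The linear factor is the sum of the variables attached to the numbers that are a part of exactly
  one of \<open>lam\<close> and \<open>mu\<close>. It is unchanged when the reflection of \<open>c\<close> is applied to both partitions,
  and it changes by \<open>wt c\<close> when the reflection is applied to \<open>mu\<close> alone. With the recursion this
  proves the identity by induction on \<open>lam\<close>.
\<close>

section \<open>Strict partitions as sets of parts\<close>

definition shape :: "nat set \<Rightarrow> bool" where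
  "shape S \<longleftrightarrow> finite S \<and> 0 \<notin> S"

text \<open>The length of the diagonal of content \<open>d\<close>: the rows meeting it are those
  whose part exceeds \<open>d\<close>.\<close>

definition cnt :: "nat set \<Rightarrow> nat \<Rightarrow> nat" where
  "cnt S d = card {a \<in> S. d < a}"

text \<open>A cell is recorded by its row and its content (column minus row, shifted by one in type D), so
  both types have the same cells and an added cell of content \<open>e\<close> turns the part \<open>e\<close> into \<open>e + 1\<close>,
  where 0 counts as a part that is always available.\<close>

definition cells :: "nat set \<Rightarrow> (nat \<times> nat) set" where
  "cells S = {(i, d). 1 \<le> i \<and> i \<le> cnt S d}"

definition addable :: "nat \<Rightarrow> nat set \<Rightarrow> bool" where
  "addable e S \<longleftrightarrow> (e = 0 \<or> e \<in> S) \<and> Suc e \<notin> S"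

definition add_corner :: "nat \<Rightarrow> nat set \<Rightarrow> nat set" where
  "add_corner e S = insert (Suc e) (S - {e})"

definition removable :: "nat \<Rightarrow> nat set \<Rightarrow> bool" where
  "removable e S \<longleftrightarrow> e \<notin> S \<and> Suc e \<in> S"

text \<open>A part 1 that loses its cell disappears, since 0 is never stored as a part.\<close>

definition remove_corner :: "nat \<Rightarrow> nat set \<Rightarrow> nat set" where
  "remove_corner e S = (if e = 0 then S - {1} else insert e (S - {Suc e}))"

lemma shape_empty [simp]: "shape {}"
  by (simp add: shape_def)

lemma shape_add [simp]: "shape S \<Longrightarrow> shape (add_corner e S)"
  by (auto simp: shape_def add_corner_def)

lemma shape_rem [simp]: "shape S \<Longrightarrow> shape (remove_corner e S)"
  by (auto simp: shape_def remove_corner_def)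

lemma removable_add: "shape S \<Longrightarrow> addable e S \<Longrightarrow> removable e (add_corner e S)"
  by (auto simp: shape_def addable_def add_corner_def removable_def)

lemma rem_add: "shape S \<Longrightarrow> addable e S \<Longrightarrow> remove_corner e (add_corner e S) = S"
  by (auto simp: shape_def addable_def add_corner_def remove_corner_def)

lemma addable_rem: "removable e S \<Longrightarrow> addable e (remove_corner e S)"
  by (auto simp: addable_def remove_corner_def removable_def)

lemma add_rem: "removable e S \<Longrightarrow> add_corner e (remove_corner e S) = S"
  by (auto simp: add_corner_def remove_corner_def removable_def)

lemma not_addable_and_removable: "shape S \<Longrightarrow> addable e S \<Longrightarrow> \<not> removable e S"
  by (auto simp: addable_def removable_def)

lemma finite_addable: "shape S \<Longrightarrow> finite {e. addable e S}"
  by (rule finite_subset[of _ "insert 0 S"]) (auto simp: addable_def shape_def)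

text \<open>Two corners have contents that differ by at least 2, so they do not interfere.\<close>

lemma removable_add_iff:
  assumes "shape S" "addable e S" "d \<noteq> e" "removable d (add_corner e S)"
  shows "removable d S \<and> addable e (remove_corner d S) \<and> remove_corner d (add_corner e S) = add_corner e (remove_corner d S)"
  using assms by (auto simp: addable_def add_corner_def removable_def remove_corner_def shape_def split: if_splits)

lemma addable_rem_iff:
  assumes "shape S" "removable d S" "d \<noteq> e" "addable e (remove_corner d S)"
  shows "addable e S \<and> removable d (add_corner e S)"
  using assms by (auto simp: addable_def add_corner_def removable_def remove_corner_def shape_def split: if_splits)

text \<open>The conditions on \<open>d\<close> and \<open>e\<close> make the pairs
  \<open>{d, d + 1}\<close> and \<open>{e, e + 1}\<close> disjoint, so the two removals touch
  different parts.\<close>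

lemma removable_rem_commute:
  assumes "shape S" "removable e S" "removable d (remove_corner e S)"
    and "d \<noteq> e" "d \<noteq> Suc e" "e \<noteq> Suc d"
  shows "removable d S" "removable e (remove_corner d S)" "remove_corner e (remove_corner d S) = remove_corner d (remove_corner e S)"
  using assms by (auto simp: removable_def remove_corner_def shape_def split: if_splits)

section \<open>Lengths of diagonals\<close>

lemma cnt_Suc: "finite S \<Longrightarrow> cnt S d = cnt S (Suc d) + of_bool (Suc d \<in> S)"
proof -
  assume fin: "finite S"
  have "d < a \<longleftrightarrow> Suc d < a \<or> a = Suc d" for a by linarith
  then have "{a \<in> S. d < a} = {a \<in> S. Suc d < a} \<union> (if Suc d \<in> S then {Suc d} else {})"
    by (simp add: set_eq_iff) blast
  then show ?thesis using fin by (auto simp: cnt_def)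
qed

lemma cnt_antimono: "finite S \<Longrightarrow> d \<le> e \<Longrightarrow> cnt S e \<le> cnt S d"
  unfolding cnt_def by (rule card_mono) auto

lemma cnt_slope: "finite S \<Longrightarrow> cnt S d \<le> cnt S (d + k) + k"
proof (induction k)
  case (Suc k)
  then show ?case using cnt_Suc[of S "d + k"] by (cases "Suc (d + k) \<in> S") auto
qed simp

lemma cnt_empty [simp]: "cnt {} d = 0"
  by (simp add: cnt_def)

lemma cells_empty [simp]: "cells {} = {}"
  by (auto simp: cells_def)

text \<open>A number \<open>d + 1\<close> is a part exactly when the length drops from
  \<open>d\<close> to \<open>d + 1\<close>.\<close>

lemma shape_eqI:
  assumes "shape S" "shape T" "\<And>d. cnt S d = cnt T d"
  shows "S = T"
proof (rule set_eqI)
  fix a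
  show "a \<in> S \<longleftrightarrow> a \<in> T"
  proof (cases a)
    case 0
    then show ?thesis using assms by (simp add: shape_def)
  next
    case (Suc d)
    have "of_bool (Suc d \<in> S) = (of_bool (Suc d \<in> T) :: nat)"
      using cnt_Suc[of S d] cnt_Suc[of T d] assms by (simp add: shape_def)
    then show ?thesis by (simp add: Suc of_bool_eq_iff)
  qed
qed

text \<open>Below \<open>e\<close> the part \<open>e\<close> and its replacement
  \<open>e + 1\<close> both count, above \<open>e\<close> neither does; only at \<open>e\<close>
  does the replacement count alone.\<close>

lemma cnt_add:
  assumes "shape S" "addable e S"
  shows "cnt (add_corner e S) d = cnt S d + of_bool (d = e)"
proof -
  have fin: "finite {a \<in> S. d < a}" using assms by (simp add: shape_def)
  consider "d < e" | "d = e" | "d > e" by linarith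
  then show ?thesis
  proof cases
    case 1
    then have "{a \<in> add_corner e S. d < a} = insert (Suc e) ({a \<in> S. d < a} - {e})"
      by (auto simp: add_corner_def)
    moreover have "Suc e \<notin> {a \<in> S. d < a}" "e \<in> {a \<in> S. d < a}"
      using assms 1 by (auto simp: addable_def)
    ultimately have "cnt (add_corner e S) d = Suc (card ({a \<in> S. d < a} - {e}))"
      unfolding cnt_def using fin by simp
    also have "\<dots> = cnt S d"
      unfolding cnt_def using fin \<open>e \<in> {a \<in> S. d < a}\<close> by (rule card_Suc_Diff1)
    finally show ?thesis using 1 by simp
  next
    case 2
    then have "{a \<in> add_corner e S. d < a} = insert (Suc e) {a \<in> S. d < a}"
      by (auto simp: add_corner_def)
    moreover have "Suc e \<notin> {a \<in> S. d < a}" using assms by (auto simp: addable_def)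
    ultimately show ?thesis using 2 fin by (auto simp: cnt_def)
  next
    case 3
    then have "{a \<in> add_corner e S. d < a} = {a \<in> S. d < a}"
      by (auto simp: add_corner_def)
    then show ?thesis using 3 by (auto simp: cnt_def)
  qed
qed

lemma cnt_rem:
  assumes "shape S" "removable e S"
  shows "cnt S d = cnt (remove_corner e S) d + of_bool (d = e)"
  using cnt_add[of "remove_corner e S" e d] assms by (simp add: addable_rem add_rem)

lemma cells_add:
  assumes "shape S" "addable e S"
  shows "cells (add_corner e S) = insert (Suc (cnt S e), e) (cells S)"
  using assms by (auto simp: cells_def cnt_add)

lemma cells_rem:
  assumes "shape S" "removable e S"
  shows "cells S = insert (cnt S e, e) (cells (remove_corner e S))"
  using cells_add[of "remove_corner e S" e] cnt_rem[OF assms, of e] assms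
  by (simp add: addable_rem add_rem)

text \<open>Since \<open>e + 1\<close> is not a part, there is no drop after \<open>e\<close>; a
  part \<open>e\<close> means a drop just before it.\<close>

lemma cnt_addable:
  assumes "shape S" "addable e S"
  shows "cnt S (Suc e) = cnt S e" "e = Suc d \<Longrightarrow> cnt S d = Suc (cnt S e)"
  using assms cnt_Suc[of S e] cnt_Suc[of S d] by (auto simp: addable_def shape_def)

lemma cells_subset_iff: "cells S \<subseteq> cells T \<longleftrightarrow> (\<forall>d. cnt S d \<le> cnt T d)"
proof
  assume sub: "cells S \<subseteq> cells T"
  show "\<forall>d. cnt S d \<le> cnt T d"
  proof
    fix d
    show "cnt S d \<le> cnt T d"
    proof (cases "cnt S d = 0")
      case False
      then have "(cnt S d, d) \<in> cells S" by (simp add: cells_def)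
      then show ?thesis using sub by (auto simp: cells_def)
    qed simp
  qed
qed (auto simp: cells_def intro: le_trans)

text \<open>A shifted diagram is closed towards the upper left; \<open>i + d\<close> is the column.
  Smaller contents have diagonals at least as long, and towards larger contents the length drops by
  at most one per step.\<close>

lemma cells_down: "shape S \<Longrightarrow> (i, d) \<in> cells S \<Longrightarrow> 1 \<le> i' \<Longrightarrow> i' + d' \<le> i + d \<Longrightarrow> i' \<le> i \<Longrightarrow> (i', d') \<in> cells S"
proof -
  assume a: "shape S" "(i, d) \<in> cells S" "1 \<le> i'" "i' + d' \<le> i + d" "i' \<le> i"
  show "(i', d') \<in> cells S"
  proof (cases "d' \<le> d")
    case True
    then show ?thesis using a cnt_antimono[of S d' d] by (auto simp: cells_def shape_def)
  next
    case False
    then show ?thesis using a cnt_slope[of S d "d' - d"] by (auto simp: cells_def shape_def)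
  qed
qed

section \<open>Excited diagrams as subwords\<close>

text \<open>The list is a linear extension of the diagram, read backwards: its head is the last cell added.\<close>

inductive reading :: "(nat \<times> nat) list \<Rightarrow> nat set \<Rightarrow> bool" where
  Nil: "reading [] {}"
| Cons: "reading w S \<Longrightarrow> addable e S \<Longrightarrow> reading ((Suc (cnt S e), e) # w) (add_corner e S)"

lemma reading_shape: "reading w S \<Longrightarrow> shape S"
  by (induction rule: reading.induct) auto

lemma set_reading: "reading w S \<Longrightarrow> set w = cells S"
  by (induction rule: reading.induct) (auto simp: cells_add reading_shape)

lemma finite_cells:
  assumes "reading w S" shows "finite (cells S)"
  using set_reading[OF assms] by (metis List.finite_set)

text \<open>The smallest part can always lose a cell: the number just below it is not a part, so
  \<open>e = Min S - 1\<close> is removable, and the sum of the parts decreases.\<close>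

lemma ex_reading: "shape S \<Longrightarrow> \<exists>w. reading w S"
proof (induction "\<Sum>S" arbitrary: S rule: less_induct)
  case less
  show ?case
  proof (cases "S = {}")
    case True
    then show ?thesis using reading.Nil by blast
  next
    case False
    have fin: "finite S" using less.prems by (simp add: shape_def)
    define e where "e = Min S - 1"
    have min: "Min S \<in> S" using False fin by simp
    then have e: "Suc e = Min S" using less.prems by (cases "Min S") (auto simp: e_def shape_def)
    have "e \<notin> S" using e Min_le[OF fin, of e] by auto
    then have r: "removable e S" using min e by (simp add: removable_def)
    have "\<Sum>S = Suc e + \<Sum>(S - {Suc e})" using fin min e by (simp add: sum.remove)
    moreover have "\<Sum>(remove_corner e S) \<le> e + \<Sum>(S - {Suc e})"
      using fin by (auto simp: remove_corner_def sum.insert_if)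
    ultimately have "\<Sum>(remove_corner e S) < \<Sum>S" by simp
    then obtain w where "reading w (remove_corner e S)"
      using less.hyps[OF _ shape_rem[OF less.prems]] by blast
    then show ?thesis using reading.Cons[OF _ addable_rem[OF r]] add_rem[OF r] by metis
  qed
qed

text \<open>Diagonal cells of type D carry two different simple reflections, alternating along the diagonal;
  \<open>linked\<close> says that cells of content \<open>d\<close> in rows \<open>i\<close> and \<open>i'\<close> carry the same one. The flag \<open>t\<close>
  selects type D.\<close>

definition linked :: "bool \<Rightarrow> nat \<Rightarrow> nat \<Rightarrow> nat \<Rightarrow> bool" where
  "linked t d i i' \<longleftrightarrow> (t \<and> d = 0 \<longrightarrow> even (i + i'))"

text \<open>The scan runs from the last cell added to the first, and a chosen letter must take a
  corner off \<open>M\<close>, so a subword has as many letters as \<open>M\<close> has cells.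
  \<open>cnt M d\<close> is the row of that corner in \<open>M\<close>; in type D the letter and the
  corner must carry the same reflection.\<close>

fun subwords :: "bool \<Rightarrow> (nat \<times> nat) list \<Rightarrow> nat set \<Rightarrow> (nat \<times> nat) set set" where
  "subwords t [] M = (if M = {} then {{}} else {})"
| "subwords t ((i, d) # w) M = subwords t w M \<union>
     (if removable d M \<and> linked t d i (cnt M d) then insert (i, d) ` subwords t w (remove_corner d M) else {})"

lemma subwords_subset: "D \<in> subwords t w M \<Longrightarrow> D \<subseteq> set w"
proof (induction t w M arbitrary: D rule: subwords.induct)
  case (2 t i d w M)
  then show ?case by (fastforce split: if_splits)
qed (auto split: if_splits)

lemma finite_subwords: "finite (subwords t w M)"
  by (induction t w M rule: subwords.induct) auto

text \<open>If no letter of the subword that fails to commute with \<open>(i, d)\<close> comes after it, then that letter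
  can be moved to the end of the subword and deleted there.\<close>

lemma subwords_remove:
  assumes "reading w S" "shape M" "D \<in> subwords t w M" "(i, d) \<in> D"
    and "\<And>r e. (r, e) \<in> D \<Longrightarrow> (e = Suc d \<longrightarrow> r < i) \<and> (e = d \<longrightarrow> r \<le> i) \<and> (Suc e = d \<longrightarrow> r \<le> i)"
  shows "removable d M \<and> linked t d i (cnt M d) \<and> D - {(i, d)} \<in> subwords t w (remove_corner d M)"
  using assms
proof (induction arbitrary: M D rule: reading.induct)
  case Nil
  then show ?case by (auto split: if_splits)
next
  case (Cons w S e)
  let ?x = "(Suc (cnt S e), e)"
  note late = Cons.prems(4)
  have S: "shape S" using Cons.hyps(1) by (rule reading_shape)
  have x: "?x \<notin> set w" using set_reading[OF Cons.hyps(1)] by (auto simp: cells_def)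
  show ?case
  proof (cases "D \<in> subwords t w M")
    case True
    then show ?thesis using Cons.IH[OF Cons.prems(1) True Cons.prems(3) late] by simp
  next
    case False
    then obtain D0 where D0: "D = insert ?x D0" "D0 \<in> subwords t w (remove_corner e M)"
      and r: "removable e M" "linked t e (Suc (cnt S e)) (cnt M e)"
      using Cons.prems(2) by (auto split: if_splits)
    have xD0: "?x \<notin> D0" using subwords_subset[OF D0(2)] x by auto
    show ?thesis
    proof (cases "?x = (i, d)")
      case True
      then have "D - {(i, d)} = D0" using D0(1) xD0 by auto
      then show ?thesis using D0(2) r True by auto
    next
      case False
      then have cD0: "(i, d) \<in> D0" using Cons.prems(3) D0 by auto
      then have "(i, d) \<in> cells S" using subwords_subset[OF D0(2)] set_reading[OF Cons.hyps(1)] by auto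
      then have i: "i \<le> cnt S d" by (simp add: cells_def)
      have l: "(e = Suc d \<longrightarrow> Suc (cnt S e) < i) \<and> (e = d \<longrightarrow> Suc (cnt S e) \<le> i) \<and> (Suc e = d \<longrightarrow> Suc (cnt S e) \<le> i)"
        using late[of "Suc (cnt S e)" e] D0 by auto
      \<comment> \<open>The head letter is the first free cell of its diagonal in \<open>S\<close>,
        and this corner fixes the lengths of the neighbouring diagonals. With
        \<open>i \<le> cnt S d\<close>, each of the three coincidences contradicts \<open>l\<close>,
        so the two letters commute.\<close>
      have ne: "d \<noteq> e" "d \<noteq> Suc e" "e \<noteq> Suc d"
        using l i cnt_addable(1)[OF S Cons.hyps(2)] cnt_addable(2)[OF S Cons.hyps(2), of d]
      by (metis Suc_n_not_le_n leD order_trans less_imp_le)+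
      have "shape (remove_corner e M)" using Cons.prems(1) by simp
      then have IH: "removable d (remove_corner e M) \<and> linked t d i (cnt (remove_corner e M) d) \<and>
          D0 - {(i, d)} \<in> subwords t w (remove_corner d (remove_corner e M))"
        using Cons.IH[of "remove_corner e M" D0] D0 cD0 late by auto
      note comm = removable_rem_commute[OF Cons.prems(1) r(1) conjunct1[OF IH] ne]
      have "cnt (remove_corner d M) e = cnt M e" using cnt_rem[OF Cons.prems(1) comm(1), of e] ne by simp
      moreover have "cnt (remove_corner e M) d = cnt M d" using cnt_rem[OF Cons.prems(1) r(1), of d] ne by simp
      moreover have "D - {(i, d)} = insert ?x (D0 - {(i, d)})" using D0 False by auto
      ultimately show ?thesis using IH comm r by auto
    qed
  qed
qed

section \<open>Excited moves in row and content\<close>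

definition next_cell :: "bool \<Rightarrow> nat \<times> nat \<Rightarrow> nat \<times> nat" where
  "next_cell t = (\<lambda>(i, d). if t \<and> d = 0 then (i + 2, 0) else (i + 1, d))"

text \<open>For \<open>d = 0\<close> in type B the truncated \<open>d - 1\<close> only repeats the target cell \<open>(i + 1, 0)\<close>, which must be
  empty anyway.\<close>

definition blockers :: "bool \<Rightarrow> nat \<times> nat \<Rightarrow> (nat \<times> nat) set" where
  "blockers t = (\<lambda>(i, d). if t \<and> d = 0 then {(i, 1), (i, 2), (i + 1, 0), (i + 1, 1), (i + 2, 0)}
     else {(i, d + 1), (i + 1, d - 1), (i + 1, d)})"

definition move :: "bool \<Rightarrow> (nat \<times> nat) set \<Rightarrow> (nat \<times> nat) set \<Rightarrow> (nat \<times> nat) set \<Rightarrow> bool" where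
  "move t L D D' \<longleftrightarrow> D \<subseteq> L \<and> (\<exists>c\<in>D. next_cell t c \<in> L \<and> blockers t c \<inter> D = {} \<and>
     D' = insert (next_cell t c) (D - {c}))"

lemma next_cell_blocker: "next_cell t c \<in> blockers t c"
  by (auto simp: next_cell_def blockers_def split: prod.splits)

text \<open>Every blocker lies weakly above and weakly left of the target cell, so a target inside
  the diagram brings the blockers along.\<close>

lemma blockers_subset: 
  assumes "shape S" "next_cell t c \<in> cells S" "c \<in> cells S"
  shows "blockers t c \<subseteq> cells S"
proof -
  obtain i d where c: "c = (i, d)" by fastforce
  show ?thesis
    using assms cells_down[OF assms(1), of "fst (next_cell t c)" "snd (next_cell t c)"]
    by (auto simp: c next_cell_def blockers_def cells_def[of S] split: if_splits)
qed

text \<open>If the target is the head letter, the empty blockers let the moved letter commute to the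
  end of the subword, where the head letter takes its place. Otherwise the move happens within the
  tail.\<close>

lemma subwords_move:
  assumes "reading w S" "shape M" "D \<in> subwords t w M" "move t (cells S) D D'"
  shows "D' \<in> subwords t w M"
  using assms
proof (induction arbitrary: M D D' rule: reading.induct)
  case Nil
  then show ?case by (auto simp: move_def)
next
  case (Cons w S e)
  let ?x = "(Suc (cnt S e), e)"
  have S: "shape S" using Cons.hyps(1) by (rule reading_shape)
  note setw = set_reading[OF Cons.hyps(1)]
  have x: "?x \<notin> cells S" by (auto simp: cells_def)
  note cells' = cells_add[OF S Cons.hyps(2)]
  from Cons.prems(3) obtain i d where c: "(i, d) \<in> D" "next_cell t (i, d) \<in> cells (add_corner e S)"
    "blockers t (i, d) \<inter> D = {}" "D' = insert (next_cell t (i, d)) (D - {(i, d)})"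
    unfolding move_def by (metis surj_pair)
  let ?c = "(i, d)" and ?c' = "next_cell t (i, d)"
  have c'D: "?c' \<notin> D" using c(3) next_cell_blocker by blast
  show ?case
  proof (cases "D \<in> subwords t w M")
    case True
    then have DS: "D \<subseteq> cells S" using subwords_subset[OF True] setw by auto
    show ?thesis
    proof (cases "?c' = ?x")
      case False
      then have "move t (cells S) D D'" using c DS unfolding move_def cells' by blast
      then show ?thesis using Cons.IH[OF Cons.prems(1) True] by simp
    next
      case eq: True
      have ed: "e = d" using eq by (auto simp: next_cell_def split: if_splits)
      \<comment> \<open>The target is the first free cell of diagonal \<open>d\<close> in
        \<open>S\<close>, so the lengths of the adjacent diagonals are known; a letter of
        \<open>D\<close> violating the bound would be a blocker.\<close>
      have late: "(e' = Suc d \<longrightarrow> r < i) \<and> (e' = d \<longrightarrow> r \<le> i) \<and> (Suc e' = d \<longrightarrow> r \<le> i)"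
        if "(r, e') \<in> D" for r e'
      proof -
        have r: "r \<le> cnt S e'" "r \<ge> 1" using that DS by (auto simp: cells_def)
        have nb: "(r, e') \<notin> blockers t (i, d)" using that c(3) by auto
        have 1: "cnt S (Suc d) = cnt S d" "Suc e' = d \<Longrightarrow> cnt S e' = Suc (cnt S d)"
          using cnt_addable[OF S Cons.hyps(2)] ed by auto
        show ?thesis
        proof (cases "t \<and> d = 0")
          case True
          then have "Suc (cnt S d) = i + 2" using eq by (auto simp: next_cell_def ed)
          then show ?thesis using r nb 1 True by (auto simp: blockers_def)
        next
          case False
          then have "cnt S d = i" using eq by (auto simp: next_cell_def ed)
          then show ?thesis using r nb 1 False
            by (auto simp: blockers_def split: if_splits intro: le_neq_implies_less)
        qed
      qed
      have "removable d M \<and> linked t d i (cnt M d) \<and> D - {(i, d)} \<in> subwords t w (remove_corner d M)"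
        by (rule subwords_remove[OF Cons.hyps(1) Cons.prems(1) True c(1) late])
      \<comment> \<open>In type D a move on the main diagonal goes down two rows, so the parity of
        the row survives.\<close>
      moreover have "linked t d (Suc (cnt S e)) k" if "linked t d i k" for k
      proof (cases "t \<and> d = 0")
        case True
        then have "cnt S e = Suc i" using eq by (simp add: next_cell_def)
        then show ?thesis using that by (simp add: linked_def)
      next
        case False
        then show ?thesis by (auto simp: linked_def)
      qed
      ultimately show ?thesis using c(4) eq ed by auto
    qed
  next
    case False
    then obtain D0 where D0: "D = insert ?x D0" "D0 \<in> subwords t w (remove_corner e M)"
      and r: "removable e M" "linked t e (Suc (cnt S e)) (cnt M e)"
      using Cons.prems(2) by (auto split: if_splits)
    have D0S: "D0 \<subseteq> cells S" using subwords_subset[OF D0(2)] setw by auto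
    have c'x: "?c' \<noteq> ?x" using c'D D0 by auto
    then have c'S: "?c' \<in> cells S" using c(2) cells' by auto
    \<comment> \<open>The head letter is the last cell of its diagonal, so it has no successor
      inside \<open>S\<close>.\<close>
    have cx: "?c \<noteq> ?x"
    proof
      assume "?c = ?x"
      then have "i = Suc (cnt S e)" "d = e" by auto
      then show False using c'S by (auto simp: next_cell_def cells_def split: if_splits)
    qed
    have "move t (cells S) D0 (insert ?c' (D0 - {?c}))"
      unfolding move_def using D0S c c'S cx D0 by auto
    then have "insert ?c' (D0 - {?c}) \<in> subwords t w (remove_corner e M)"
      using Cons.IH[of "remove_corner e M"] Cons.prems(1) D0 by simp
    moreover have "D' = insert ?x (insert ?c' (D0 - {?c}))" using c(4) D0 cx by auto
    ultimately show ?thesis using r by auto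
  qed
qed

lemma linked_refl [simp]: "linked t d i i"
  by (simp add: linked_def)

text \<open>A corner of the larger diagram that lies in \<open>cells M\<close> is a corner of
  \<open>M\<close> too, so the scan can delete it; a letter outside \<open>cells M\<close> is
  skipped.\<close>

lemma cells_in_subwords:
  assumes "reading w S" "shape M" "cells M \<subseteq> cells S"
  shows "cells M \<in> subwords t w M"
  using assms
proof (induction arbitrary: M rule: reading.induct)
  case Nil
  have "M = {}"
    by (rule shape_eqI) (use Nil cells_subset_iff[of M "{}"] in auto)
  then show ?case by simp
next
  case (Cons w S e)
  let ?x = "(Suc (cnt S e), e)"
  have S: "shape S" using Cons.hyps(1) by (rule reading_shape)
  have le: "cnt M d \<le> cnt S d + of_bool (d = e)" for d
    using Cons.prems(2) cnt_add[OF S Cons.hyps(2)] by (simp add: cells_subset_iff)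
  show ?case
  proof (cases "?x \<in> cells M")
    case False
    then have "cells M \<subseteq> cells S" using Cons.prems(2) cells_add[OF S Cons.hyps(2)] by auto
    then show ?thesis using Cons.IH Cons.prems by simp
  next
    case True
    then have e: "cnt M e = Suc (cnt S e)" using le[of e] by (auto simp: cells_def)
    have fin: "finite M" using Cons.prems(1) by (simp add: shape_def)
    have "Suc e \<in> M"
      using cnt_Suc[OF fin, of e] le[of "Suc e"] e cnt_addable(1)[OF S Cons.hyps(2)]
      by (cases "Suc e \<in> M") auto
    \<comment> \<open>A part \<open>e\<close> would make diagonal \<open>e - 1\<close> of
      \<open>M\<close> longer than that of \<open>S\<close>.\<close>
    moreover have "e \<notin> M"
    proof
      assume "e \<in> M"
      then obtain d where d: "e = Suc d" using Cons.prems(1) by (cases e) (auto simp: shape_def)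
      show False
        using cnt_Suc[OF fin, of d] d \<open>e \<in> M\<close> e le[of d] cnt_addable(2)[OF S Cons.hyps(2), of d] by auto
    qed
    ultimately have r: "removable e M" by (simp add: removable_def)
    have "cnt (remove_corner e M) d \<le> cnt S d" for d
      using cnt_rem[OF Cons.prems(1) r, of d] le[of d] by simp
    then have "cells (remove_corner e M) \<in> subwords t w (remove_corner e M)"
      using Cons.IH[of "remove_corner e M"] Cons.prems by (simp add: cells_subset_iff)
    then show ?thesis using r e cells_rem[OF Cons.prems(1) r] by auto
  qed
qed

lemma move_mono: "move t L D D' \<Longrightarrow> L \<subseteq> L' \<Longrightarrow> move t L' D D'"
  unfolding move_def by blast

text \<open>All blockers of a move inside \<open>S\<close> lie in \<open>S\<close>, so a cell
  outside \<open>S\<close> cannot obstruct it.\<close>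

lemma move_insert:
  assumes "shape S" "move t (cells S) D D'" "x \<notin> cells S" "cells S' = insert x (cells S)"
  shows "move t (cells S') (insert x D) (insert x D')"
proof -
  obtain c where D: "D \<subseteq> cells S" and c: "c \<in> D" "next_cell t c \<in> cells S" "blockers t c \<inter> D = {}"
     "D' = insert (next_cell t c) (D - {c})" using assms(2) unfolding move_def by blast
  have "x \<notin> blockers t c" using blockers_subset[OF assms(1) c(2)] c(1) D assms(3) by auto
  then show ?thesis unfolding move_def
    using c D assms by (intro conjI bexI[of _ c]) auto
qed

text \<open>Past the end of diagonal \<open>e\<close> no blocker lies in \<open>M\<close>: at a
  corner, diagonals \<open>e + 1\<close> and \<open>e + 2\<close> are no longer than diagonal
  \<open>e\<close>, and diagonal \<open>e - 1\<close> is longer by just one. On the main diagonal of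
  type D only rows of equal parity are visited, whence \<open>linked\<close>.\<close>

lemma slide:
  assumes S: "shape S" and M: "shape M" and e: "addable e M"
    and sub: "cells M \<subseteq> cells S" and i: "Suc (cnt M e) \<le> i" "i \<le> cnt S e"
    and l: "linked t e i (Suc (cnt M e))"
  shows "(move t (cells S))\<^sup>*\<^sup>* (insert (Suc (cnt M e), e) (cells M)) (insert (i, e) (cells M))"
  using i l
proof (induction i rule: less_induct)
  case (less i)
  show ?case
  proof (cases "i = Suc (cnt M e)")
    case False
    \<comment> \<open>The row visited just before \<open>i\<close>: two rows up on the main diagonal
      of type D, one row up elsewhere.\<close>
    define j where "j = (if t \<and> e = 0 then i - 2 else i - 1)"
    have j: "Suc (cnt M e) \<le> j" "j < i" "linked t e j (Suc (cnt M e))" "next_cell t (j, e) = (i, e)"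
      using False less.prems by (auto simp: j_def linked_def next_cell_def split: if_splits; presburger)+
    have bl: "blockers t (j, e) \<inter> insert (j, e) (cells M) = {}"
    proof -
      have *: "cnt M (Suc e) = cnt M e" "e > 0 \<Longrightarrow> cnt M (e - 1) = Suc (cnt M e)"
        using cnt_addable[OF M e] by (auto simp: gr0_conv_Suc)
      have "cnt M (Suc (Suc e)) \<le> cnt M e" using M by (intro cnt_antimono) (auto simp: shape_def)
      then show ?thesis using j(1) * 
        by (cases "e = 0") (auto simp: blockers_def cells_def numeral_2_eq_2)
    qed
    have "move t (cells S) (insert (j, e) (cells M)) (insert (i, e) (cells M))"
      unfolding move_def
    proof (intro conjI bexI[of _ "(j, e)"])
      show "insert (j, e) (cells M) \<subseteq> cells S" using sub j less.prems by (auto simp: cells_def)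
      have "(j, e) \<notin> cells M" using j by (auto simp: cells_def)
      then show "insert (i, e) (cells M) = insert (next_cell t (j, e)) (insert (j, e) (cells M) - {(j, e)})"
        using j by auto
      show "next_cell t (j, e) \<in> cells S" using j less.prems by (auto simp: cells_def)
    qed (use bl in auto)
    then show ?thesis using less.IH[OF j(2,1) _ j(3)] j(2) less.prems by (meson le_trans less_imp_le rtranclp.rtrancl_into_rtrancl)
  qed simp
qed

text \<open>When the head letter is chosen, the corner it takes off \<open>M\<close> is first slid
  down to the head cell; the remaining moves then run undisturbed by that cell.\<close>

lemma subwords_reachable:
  assumes "reading w S" "shape M" "D \<in> subwords t w M"
  shows "cells M \<subseteq> cells S \<and> (move t (cells S))\<^sup>*\<^sup>* (cells M) D"
  using assms
proof (induction arbitrary: M D rule: reading.induct)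
  case Nil
  then show ?case by (auto split: if_splits)
next
  case (Cons w S e)
  let ?x = "(Suc (cnt S e), e)" and ?L = "cells (add_corner e S)"
  have S: "shape S" using Cons.hyps(1) by (rule reading_shape)
  have x: "?x \<notin> cells S" by (auto simp: cells_def)
  note cells' = cells_add[OF S Cons.hyps(2)]
  show ?case
  proof (cases "D \<in> subwords t w M")
    case True
    have "(move t (cells S))\<^sup>*\<^sup>* \<le> (move t ?L)\<^sup>*\<^sup>*"
      by (rule rtranclp_mono) (auto simp: cells' intro: move_mono)
    then show ?thesis using Cons.IH[OF Cons.prems(1) True] cells' by auto
  next
    case False
    then obtain D0 where D0: "D = insert ?x D0" "D0 \<in> subwords t w (remove_corner e M)"
      and r: "removable e M" "linked t e (Suc (cnt S e)) (cnt M e)"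
      using Cons.prems(2) by (auto split: if_splits)
    let ?M = "remove_corner e M"
    have M: "shape ?M" using Cons.prems(1) by simp
    have IH: "cells ?M \<subseteq> cells S" "(move t (cells S))\<^sup>*\<^sup>* (cells ?M) D0"
      using Cons.IH[OF M D0(2)] by auto
    have ce: "cnt M e = Suc (cnt ?M e)" using cnt_rem[OF Cons.prems(1) r(1), of e] by simp
    note cM = cells_rem[OF Cons.prems(1) r(1)]
    have le: "cnt ?M d \<le> cnt S d" for d using IH(1) by (simp add: cells_subset_iff)
    have "cells M \<subseteq> ?L"
      using cnt_rem[OF Cons.prems(1) r(1)] le cnt_add[OF S Cons.hyps(2)] by (simp add: cells_subset_iff)
    moreover have "(move t ?L)\<^sup>*\<^sup>* (cells M) (insert ?x (cells ?M))"
      unfolding cM ce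
      by (rule slide) (use S M r IH ce cells' le cnt_add[OF S Cons.hyps(2)] addable_rem in \<open>auto\<close>)
    moreover have "(move t ?L)\<^sup>*\<^sup>* (insert ?x (cells ?M)) (insert ?x D0)"
      using IH(2)
    proof (induction rule: rtranclp_induct)
      case (step D1 D2)
      then show ?case using move_insert[OF S step(2) x cells'] by auto
    qed simp
    ultimately show ?thesis using D0(1) by auto
  qed
qed

lemma reachable_eq_subwords:
  assumes "reading w S" "shape M"
  shows "{D. cells M \<subseteq> cells S \<and> (move t (cells S))\<^sup>*\<^sup>* (cells M) D} = subwords t w M"
proof (intro equalityI subsetI)
  fix D assume "D \<in> {D. cells M \<subseteq> cells S \<and> (move t (cells S))\<^sup>*\<^sup>* (cells M) D}"
  then have "cells M \<subseteq> cells S" "(move t (cells S))\<^sup>*\<^sup>* (cells M) D" by auto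
  from this(2,1) show "D \<in> subwords t w M"
    by (induction rule: rtranclp_induct) (auto intro: cells_in_subwords subwords_move assms)
qed (use subwords_reachable[OF assms] in auto)

definition cell_weight :: "bool \<Rightarrow> (nat \<Rightarrow> 'a::comm_ring_1) \<Rightarrow> nat \<times> nat \<Rightarrow> 'a" where
  "cell_weight t x = (\<lambda>(i, d). if \<not> t \<and> d = 0 then x i else x i + x (i + d + of_bool t))"

section \<open>The Chevalley formula\<close>

text \<open>The variable attached to the number \<open>a\<close>: that of its row if \<open>a\<close> is a part of \<open>S\<close>, that of the column
  of the corresponding gap otherwise. In type D the index 0 counts as a gap as well.\<close>

definition position :: "bool \<Rightarrow> nat set \<Rightarrow> nat \<Rightarrow> nat" where
  "position t S a = cnt S a + (if a \<in> S then 1 else a + of_bool t)"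

text \<open>In type D the part 0 is added when needed to make the number of parts even.\<close>

definition even_ext :: "bool \<Rightarrow> nat set \<Rightarrow> nat set" where
  "even_ext t S = S \<union> (if t \<and> odd (card S) then {0} else {})"

definition disagree :: "bool \<Rightarrow> nat set \<Rightarrow> nat set \<Rightarrow> nat set" where
  "disagree t S M = {a. a \<in> even_ext t S \<longleftrightarrow> a \<notin> even_ext t M}"

definition chevalley_factor :: "bool \<Rightarrow> (nat \<Rightarrow> 'a::comm_ring_1) \<Rightarrow> nat set \<Rightarrow> nat set \<Rightarrow> 'a" where
  "chevalley_factor t x S M = (\<Sum>a\<in>disagree t S M. x (position t S a))"

text \<open>Adding a cell of content \<open>e\<close> exchanges the roles of \<open>e\<close> and
  \<open>e + 1\<close>. In type B the diagonal letter only changes whether 1 is a part and keeps its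
  position, hence the identity.\<close>

definition part_swap :: "bool \<Rightarrow> nat \<Rightarrow> nat \<Rightarrow> nat" where
  "part_swap t e a = (if \<not> t \<and> e = 0 then a else transpose e (Suc e) a)"

lemma swap_swap [simp]: "part_swap t e (part_swap t e a) = a"
  by (simp add: part_swap_def)

lemma swap_simps:
  "t \<or> e > 0 \<Longrightarrow> part_swap t e e = Suc e" "t \<or> e > 0 \<Longrightarrow> part_swap t e (Suc e) = e"
  "a \<noteq> e \<Longrightarrow> a \<noteq> Suc e \<Longrightarrow> part_swap t e a = a" "part_swap False 0 a = a"
  by (auto simp: part_swap_def)

lemma finite_disagree:
  assumes "shape S" "shape M" shows "finite (disagree t S M)"
  by (rule finite_subset[of _ "S \<union> M \<union> {0}"])
    (use assms in \<open>auto simp: disagree_def even_ext_def shape_def split: if_splits\<close>)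

lemma zero_disagree: "shape S \<Longrightarrow> shape M \<Longrightarrow> 0 \<in> disagree t S M \<longleftrightarrow> t \<and> odd (card S + card M)"
  by (auto simp: disagree_def even_ext_def shape_def)

lemma pos_disagree: "a > 0 \<Longrightarrow> a \<in> disagree t S M \<longleftrightarrow> (a \<in> S \<longleftrightarrow> a \<notin> M)"
  by (auto simp: disagree_def even_ext_def)

lemma cnt_0: "shape S \<Longrightarrow> cnt S 0 = card S"
  unfolding cnt_def shape_def by (rule arg_cong[of _ _ card]) (auto intro: gr0I)

lemma mem_add: "b \<in> add_corner e S \<longleftrightarrow> b = Suc e \<or> b \<in> S \<and> b \<noteq> e"
  by (auto simp: add_corner_def)

lemma mem_rem: "b \<in> remove_corner e S \<longleftrightarrow> b = e \<and> e > 0 \<or> b \<in> S \<and> b \<noteq> Suc e"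
  by (auto simp: remove_corner_def)

text \<open>The part \<open>e\<close> becomes \<open>e + 1\<close> in the same row, and the gap
  \<open>e + 1\<close> becomes the gap \<open>e\<close> in the same column. In type B the number 0
  carries no variable.\<close>

lemma position_swap:
  assumes "shape S" "addable e S" "t \<or> a > 0"
  shows "position t (add_corner e S) (part_swap t e a) = position t S a"
proof (cases "\<not> t \<and> e = 0")
  case True
  then show ?thesis using assms
    by (auto simp: part_swap_def position_def cnt_add mem_add addable_def)
next
  case False
  then have te: "t \<or> e > 0" by auto
  consider "a = e" | "a = Suc e" | "a \<noteq> e" "a \<noteq> Suc e" by blast
  then show ?thesis
    using assms te cnt_addable(1)[OF assms(1,2)]
    by cases (auto simp: swap_simps position_def cnt_add mem_add addable_def shape_def)
qed

text \<open>The letter acts on membership in \<open>even_ext\<close> by \<open>part_swap\<close>,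
  followed on the main diagonal by a complement: at 1 in type B, and at 0 and 1 in type D if the row
  is odd. Linked letters act alike, so the complements cancel in \<open>disagree\<close>; in the
  third case the same action fixes \<open>M\<close>.\<close>

lemma disagree_swap:
  assumes S: "shape S" "addable e S" and M: "shape M"
  shows disagree_swap_rem:
      "removable e M \<Longrightarrow> linked t e (Suc (cnt S e)) (cnt M e) \<Longrightarrow>
        a \<in> disagree t (add_corner e S) M \<longleftrightarrow> part_swap t e a \<in> disagree t S (remove_corner e M)"
    and disagree_swap_add:
      "addable e M \<Longrightarrow> linked t e (Suc (cnt S e)) (Suc (cnt M e)) \<Longrightarrow>
        a \<in> disagree t (add_corner e S) M \<longleftrightarrow> part_swap t e a \<in> disagree t S (add_corner e M)"
    and disagree_swap_id:
      "\<not> (removable e M \<and> linked t e (Suc (cnt S e)) (cnt M e)) \<Longrightarrow>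
       \<not> (addable e M \<and> linked t e (Suc (cnt S e)) (Suc (cnt M e))) \<Longrightarrow>
        a \<in> disagree t (add_corner e S) M \<longleftrightarrow> part_swap t e a \<in> disagree t S M"
proof -
  have card_add: "card (add_corner e N) = card N + of_bool (e = 0)" if "shape N" "addable e N" for N
    using cnt_add[OF that, of 0] cnt_0[of N] cnt_0[of "add_corner e N"] that by simp
  have card_rem: "card N = card (remove_corner e N) + of_bool (e = 0)" if "shape N" "removable e N" for N
    using card_add[of "remove_corner e N"] that by (simp add: addable_rem add_rem)
  have zero: "0 \<notin> S" "0 \<notin> M" using assms by (auto simp: shape_def)
  note ar = addable_def removable_def
  consider (B) "\<not> t" "e = 0" | (D) "t" "e = 0" | (pos) "e > 0" by blast
  note c3 = this
  have cases_a: "a = 0 \<or> a = e \<or> a = Suc e \<or> a > 0 \<and> a \<noteq> e \<and> a \<noteq> Suc e" by linarith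
  {
    assume r: "removable e M" "linked t e (Suc (cnt S e)) (cnt M e)"
    show "a \<in> disagree t (add_corner e S) M \<longleftrightarrow> part_swap t e a \<in> disagree t S (remove_corner e M)"
      using c3
    proof cases
      case D
      then show ?thesis
        using cases_a r S M zero card_add[OF S] card_rem[OF M r(1)]
        by (elim disjE) (auto simp: swap_simps disagree_def even_ext_def mem_add mem_rem linked_def cnt_0 ar)
    qed (use cases_a r S M zero card_add[OF S] card_rem[OF M r(1)] in
        \<open>elim disjE; auto simp: swap_simps disagree_def even_ext_def mem_add mem_rem ar\<close>)+
  }
  {
    assume r: "addable e M" "linked t e (Suc (cnt S e)) (Suc (cnt M e))"
    show "a \<in> disagree t (add_corner e S) M \<longleftrightarrow> part_swap t e a \<in> disagree t S (add_corner e M)"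
      using c3
    proof cases
      case D
      then show ?thesis
        using cases_a r S M zero card_add[OF S] card_add[OF M r(1)]
        by (elim disjE) (auto simp: swap_simps disagree_def even_ext_def mem_add linked_def cnt_0 ar)
    qed (use cases_a r S M zero card_add[OF S] card_add[OF M r(1)] in
        \<open>elim disjE; auto simp: swap_simps disagree_def even_ext_def mem_add ar\<close>)+
  }
  {
    assume r: "\<not> (removable e M \<and> linked t e (Suc (cnt S e)) (cnt M e))"
      "\<not> (addable e M \<and> linked t e (Suc (cnt S e)) (Suc (cnt M e)))"
    show "a \<in> disagree t (add_corner e S) M \<longleftrightarrow> part_swap t e a \<in> disagree t S M"
      using c3
    proof cases
      case D
      then show ?thesis
        using cases_a r S M zero card_add[OF S]
        by (elim disjE) (auto simp: swap_simps disagree_def even_ext_def mem_add linked_def cnt_0 ar)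
    qed (use cases_a r S M zero card_add[OF S] in
        \<open>elim disjE; auto simp: swap_simps disagree_def even_ext_def mem_add linked_def ar\<close>)+
  }
qed

lemma factor_eqI:
  assumes "shape S" "addable e S" "shape M" "shape N"
    and "\<And>a. a \<in> disagree t (add_corner e S) M \<longleftrightarrow> part_swap t e a \<in> disagree t S N"
  shows "chevalley_factor t x (add_corner e S) M = chevalley_factor t x S N"
  unfolding chevalley_factor_def
proof (rule sum.reindex_bij_witness[of _ "part_swap t e" "part_swap t e"])
  fix a assume "a \<in> disagree t (add_corner e S) M"
  then have a: "part_swap t e a \<in> disagree t S N" using assms by simp
  then show "part_swap t e a \<in> disagree t S N" .
  \<comment> \<open>In type B the number 0 never lies in \<open>disagree\<close>, so
    \<open>position_swap\<close> applies to every summand.\<close>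
  have "t \<or> part_swap t e a > 0" using a zero_disagree[OF assms(1,4)] by (metis gr0I)
  then show "x (position t S (part_swap t e a)) = x (position t (add_corner e S) a)"
    using position_swap[OF assms(1,2), of t "part_swap t e a"] by simp
qed (use assms in auto)

text \<open>\<open>add_corner e S\<close> and \<open>M\<close> agree at \<open>e\<close> and
  \<open>e + 1\<close> before the removal and disagree at both after it. The positions of
  \<open>e\<close> and \<open>e + 1\<close> are the column and the row of the new cell, whose
  variables make up its weight; for a diagonal cell of type B only \<open>e + 1\<close>
  counts.\<close>

lemma factor_rem:
  assumes S: "shape S" "addable e S" and M: "shape M" "removable e M"
    and l: "linked t e (Suc (cnt S e)) (cnt M e)"
  shows "chevalley_factor t x (add_corner e S) (remove_corner e M) = chevalley_factor t x (add_corner e S) M + cell_weight t x (Suc (cnt S e), e)"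
proof -
  let ?K = "if \<not> t \<and> e = 0 then {Suc e} else {e, Suc e}"
  have zero: "0 \<notin> S" "0 \<notin> M" using assms by (auto simp: shape_def)
  have cards: "e = 0 \<Longrightarrow> card (add_corner e S) = Suc (card S)" "card M = card (remove_corner e M) + of_bool (e = 0)"
    using cnt_add[OF S, of 0] cnt_0[of S] cnt_0[of "add_corner e S"] cnt_rem[OF M, of 0] cnt_0[of M] cnt_0[of "remove_corner e M"] S M
    by simp_all
  have un: "disagree t (add_corner e S) (remove_corner e M) = ?K \<union> disagree t (add_corner e S) M"
    and int: "?K \<inter> disagree t (add_corner e S) M = {}"
    using zero M S l cards
    by (auto simp: disagree_def even_ext_def add_corner_def remove_corner_def removable_def addable_def linked_def cnt_0
        split: if_splits)
  have "position t (add_corner e S) e = Suc (cnt S e) + e + of_bool t"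
    using S by (auto simp: position_def cnt_add mem_add addable_def shape_def)
  moreover have "position t (add_corner e S) (Suc e) = Suc (cnt S e)"
    using S cnt_addable(1)[OF S] by (auto simp: position_def cnt_add mem_add)
  ultimately have "(\<Sum>a\<in>?K. x (position t (add_corner e S) a)) = cell_weight t x (Suc (cnt S e), e)"
    by (auto simp: cell_weight_def add.commute)
  then show ?thesis unfolding chevalley_factor_def un
    by (subst sum.union_disjoint) (use int finite_disagree S M in auto)
qed

section \<open>Weighted sums over subwords\<close>

definition excited_sum :: "bool \<Rightarrow> (nat \<Rightarrow> 'a::comm_ring_1) \<Rightarrow> (nat \<times> nat) list \<Rightarrow> nat set \<Rightarrow> 'a" where
  "excited_sum t x w M = (\<Sum>D\<in>subwords t w M. \<Prod>c\<in>D. cell_weight t x c)"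

lemma excited_sum_Cons:
  assumes "(i, d) \<notin> set w"
  shows "excited_sum t x ((i, d) # w) M = excited_sum t x w M +
    (if removable d M \<and> linked t d i (cnt M d)
     then cell_weight t x (i, d) * excited_sum t x w (remove_corner d M) else 0)"
proof (cases "removable d M \<and> linked t d i (cnt M d)")
  case True
  have notin: "(i, d) \<notin> D" if "D \<in> subwords t w N" for D N
    using subwords_subset[OF that] assms by auto
  have inj: "inj_on (insert (i, d)) (subwords t w (remove_corner d M))"
    by (rule inj_onI) (metis Diff_insert_absorb notin)
  have "excited_sum t x ((i, d) # w) M = excited_sum t x w M +
      (\<Sum>D\<in>insert (i, d) ` subwords t w (remove_corner d M). \<Prod>c\<in>D. cell_weight t x c)"
    unfolding excited_sum_def using True
    by (simp, subst sum.union_disjoint) (use finite_subwords notin[of _ M] in \<open>auto\<close>)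
  also have "(\<Sum>D\<in>insert (i, d) ` subwords t w (remove_corner d M). \<Prod>c\<in>D. cell_weight t x c) =
      (\<Sum>D\<in>subwords t w (remove_corner d M). cell_weight t x (i, d) * (\<Prod>c\<in>D. cell_weight t x c))"
  proof (subst sum.reindex[OF inj], rule sum.cong)
    fix D assume D: "D \<in> subwords t w (remove_corner d M)"
    have "finite D" using subwords_subset[OF D] finite_subset by blast
    then show "((\<lambda>D. prod (cell_weight t x) D) \<circ> insert (i, d)) D = cell_weight t x (i, d) * prod (cell_weight t x) D"
      using notin[OF D] by simp
  qed simp
  finally show ?thesis using True by (simp add: excited_sum_def sum_distrib_left)
qed (auto simp: excited_sum_def)

text \<open>In the step to \<open>add_corner e S\<close>, the cases are whether the reflection of the new cell removes a cell
  of \<open>M\<close>, adds one, or fixes \<open>M\<close>. In the first case the term for \<open>M\<close> in the induction hypothesis for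
  \<open>remove_corner e M\<close> cancels the change of the linear factor.\<close>

theorem chevalley_formula:
  assumes "reading w S" "shape M"
  shows "chevalley_factor t x S M * excited_sum t x w M = (\<Sum>e | addable e M. excited_sum t x w (add_corner e M))"
  using assms
proof (induction arbitrary: M rule: reading.induct)
  case Nil
  \<comment> \<open>Either \<open>M\<close> is empty and the factor is an empty sum, or
    \<open>M\<close> has no subword.\<close>
  have "chevalley_factor t x {} M * excited_sum t x [] M = 0"
    by (auto simp: chevalley_factor_def excited_sum_def disagree_def even_ext_def)
  moreover have "excited_sum t x [] (add_corner e M) = 0" for e
    by (auto simp: excited_sum_def add_corner_def)
  ultimately show ?case by simp
next
  case (Cons w S e)
  note M = Cons.prems
  have S: "shape S" using Cons.hyps(1) by (rule reading_shape)
  let ?i = "Suc (cnt S e)"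
  let ?b = "cell_weight t x (?i, e)"
  let ?Z = "excited_sum t x w" and ?Z' = "excited_sum t x ((?i, e) # w)"
  let ?r = "\<lambda>N. removable e N \<and> linked t e ?i (cnt N e)"
  let ?q = "\<lambda>f. if ?r (add_corner f M) then ?b * ?Z (remove_corner e (add_corner f M)) else 0"
  have "(?i, e) \<notin> set w" using set_reading[OF Cons.hyps(1)] by (auto simp: cells_def)
  note Z' = excited_sum_Cons[OF this, of t x]
  have fin: "finite {f. addable f M}" using finite_addable[OF M] .
  have rhs: "(\<Sum>f | addable f M. ?Z' (add_corner f M)) = chevalley_factor t x S M * ?Z M + (\<Sum>f | addable f M. ?q f)"
    unfolding Z' sum.distrib Cons.IH[OF M] ..
  have r_add: "?r (add_corner f M) \<longleftrightarrow> removable e (add_corner f M) \<and> linked t e ?i (cnt M e)"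
    if "addable f M" "f \<noteq> e" for f
    using cnt_add[OF M that(1), of e] that(2) by auto
  consider (rem) "?r M" | (add) "addable e M" "linked t e ?i (Suc (cnt M e))" | 
    (none) "\<not> ?r M" "\<not> (addable e M \<and> linked t e ?i (Suc (cnt M e)))" by blast
  then show ?case
  proof cases
    case rem
    let ?K = "remove_corner e M"
    have K: "shape ?K" "addable e ?K" "add_corner e ?K = M" using M rem by (auto simp: addable_rem add_rem)
    have ne: "f \<noteq> e" if "addable f M" for f using that rem not_addable_and_removable[OF M] by auto
    have "(\<Sum>f | addable f M. ?q f) = (\<Sum>f | addable f M \<and> removable e (add_corner f M). ?b * ?Z (add_corner f ?K))"
    proof (rule sum.mono_neutral_cong_right[OF fin])
      fix f assume "f \<in> {f. addable f M \<and> removable e (add_corner f M)}"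
      then have f: "addable f M" "removable e (add_corner f M)" "f \<noteq> e" using ne by auto
      then have "remove_corner e (add_corner f M) = add_corner f ?K" using removable_add_iff[OF M f(1) _ f(2)] by auto
      then show "?q f = ?b * ?Z (add_corner f ?K)" using r_add[OF f(1,3)] f(2) rem by simp
    qed (use ne r_add in auto)
    also have "{f. addable f M \<and> removable e (add_corner f M)} = {f. addable f ?K} - {e}"
    proof (rule set_eqI)
      fix f
      show "f \<in> {f. addable f M \<and> removable e (add_corner f M)} \<longleftrightarrow> f \<in> {f. addable f ?K} - {e}"
        using removable_add_iff[OF M, of f e] addable_rem_iff[OF M, of e f] rem ne[of f] by auto
    qed
    \<comment> \<open>The induction hypothesis for \<open>?K\<close> sums over all its corners; the
      corner \<open>e\<close> gives back \<open>M\<close> and is subtracted.\<close>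
    also have "(\<Sum>f\<in>{f. addable f ?K} - {e}. ?b * ?Z (add_corner f ?K)) = ?b * (chevalley_factor t x S ?K * ?Z ?K - ?Z M)"
      unfolding Cons.IH[OF K(1)] using K finite_addable[OF K(1)]
      by (simp add: sum_distrib_left[symmetric] sum_diff1)
    finally have q: "(\<Sum>f | addable f M. ?q f) = \<dots>" .
    have "chevalley_factor t x (add_corner e S) M = chevalley_factor t x S ?K"
      by (rule factor_eqI) (use S M Cons.hyps K disagree_swap_rem rem in auto)
    moreover have "chevalley_factor t x (add_corner e S) ?K = chevalley_factor t x S M"
    proof (rule factor_eqI)
      fix a
      have "linked t e ?i (Suc (cnt ?K e))" using rem cnt_rem[OF M, of e e] by simp
      then show "a \<in> disagree t (add_corner e S) ?K \<longleftrightarrow> part_swap t e a \<in> disagree t S M"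
        using disagree_swap_add[OF S Cons.hyps(2) K(1,2), of t a] K(3) by simp
    qed (use S M Cons.hyps K in auto)
    moreover have "chevalley_factor t x (add_corner e S) ?K = chevalley_factor t x (add_corner e S) M + ?b"
      by (rule factor_rem) (use S M Cons.hyps rem in auto)
    ultimately have f: "chevalley_factor t x (add_corner e S) M = chevalley_factor t x S ?K" "chevalley_factor t x S M = chevalley_factor t x S ?K + ?b"
      by auto
    show ?thesis unfolding rhs q f unfolding Z' using rem by (simp add: algebra_simps)
  next
    case add
    let ?K = "add_corner e M"
    have nr: "\<not> removable e M" using not_addable_and_removable[OF M add(1)] .
    have K: "shape ?K" "removable e ?K" "remove_corner e ?K = M" "cnt ?K e = Suc (cnt M e)"
      using M add by (auto simp: removable_add rem_add cnt_add)
    \<comment> \<open>Content \<open>e\<close> is not removable in \<open>M\<close>, and adding a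
      corner of another content does not make it so.\<close>
    have "(\<Sum>f | addable f M. ?q f) = (\<Sum>f\<in>{e}. ?q f)"
      by (rule sum.mono_neutral_right[OF fin])
        (use add nr removable_add_iff[OF M] in auto)
    also have "\<dots> = ?b * ?Z M" using K add by simp
    finally have q: "(\<Sum>f | addable f M. ?q f) = \<dots>" .
    have "chevalley_factor t x (add_corner e S) M = chevalley_factor t x S ?K"
      by (rule factor_eqI) (use S M Cons.hyps K disagree_swap_add add in auto)
    moreover have "chevalley_factor t x (add_corner e S) ?K = chevalley_factor t x S M"
      using disagree_swap_rem[OF S Cons.hyps(2) K(1,2), of t] K add
      by (intro factor_eqI) (use S M Cons.hyps in auto)
    moreover have "chevalley_factor t x (add_corner e S) M = chevalley_factor t x (add_corner e S) ?K + ?b"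
      using factor_rem[OF S Cons.hyps(2) K(1,2), of t x] K add by simp
    ultimately have f: "chevalley_factor t x (add_corner e S) M = chevalley_factor t x S M + ?b" by simp
    show ?thesis unfolding rhs q f unfolding Z' using nr by (simp add: algebra_simps)
  next
    case none
    \<comment> \<open>For \<open>f = e\<close> the added corner is not linked to the letter; for any
      other \<open>f\<close> a linked removable corner would already exist in
      \<open>M\<close>.\<close>
    have "?q f = 0" if f: "addable f M" for f
    proof (cases "f = e")
      case True
      then show ?thesis using none(2) f cnt_add[OF M f] by auto
    next
      case False
      then show ?thesis using none(1) r_add[OF f False] removable_add_iff[OF M f, of e] by auto
    qed
    then have q: "(\<Sum>f | addable f M. ?q f) = 0" by simp
    have f: "chevalley_factor t x (add_corner e S) M = chevalley_factor t x S M"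
      by (rule factor_eqI) (use S M Cons.hyps disagree_swap_id none in auto)
    show ?thesis unfolding rhs q f unfolding Z' using none(1) by auto
  qed
qed

section \<open>Diagrams and covers of strict partitions\<close>

lemma shape_set: "strict_partition lam \<Longrightarrow> shape (set lam)"
  by (auto simp: strict_partition_def shape_def)

lemma distinct_strict_partition: "strict_partition lam \<Longrightarrow> distinct lam"
  unfolding strict_partition_def by (induction lam) auto

text \<open>Parts decrease, so those exceeding \<open>d\<close> fill the first rows.\<close>

lemma strict_part_gt:
  assumes "strict_partition lam" "1 \<le> i"
  shows "d < strict_part lam i \<longleftrightarrow> i \<le> cnt (set lam) d"
  using assms
proof (induction lam arbitrary: i)
  case Nil
  then show ?case by (simp add: strict_part_def)
next
  case (Cons a l)
  have l: "strict_partition l" "\<forall>b\<in>set l. b < a" using Cons.prems by (auto simp: strict_partition_def)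
  have "{b \<in> set (a # l). d < b} = (if d < a then insert a {b \<in> set l. d < b} else {})"
    using l by auto
  moreover have "a \<notin> set l" using l by auto
  ultimately have cnt: "cnt (set (a # l)) d = (if d < a then Suc (cnt (set l) d) else 0)"
    unfolding cnt_def by simp
  show ?case
  proof (cases "i = 1")
    case True
    then show ?thesis unfolding cnt by (simp add: strict_part_def)
  next
    case False
    then obtain k where k: "i = Suc k" "1 \<le> k" using Cons.prems by (cases i) auto
    have "strict_part (a # l) i = strict_part l k" using k by (simp add: strict_part_def)
    moreover have "\<not> d < strict_part l k" if "\<not> d < a"
    proof -
      have "l ! (k - 1) < a" if "k \<le> length l" using that k l(2) by simp
      then show ?thesis using that by (auto simp: strict_part_def)
    qed
    ultimately show ?thesis unfolding cnt using Cons.IH[OF l(1) k(2)] k by auto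
  qed
qed

lemma cnt_le_length: "cnt (set lam) d \<le> length lam"
  unfolding cnt_def by (rule order_trans[OF card_mono card_length]) auto

definition coord :: "bool \<Rightarrow> nat \<times> nat \<Rightarrow> nat \<times> nat" where
  "coord t = (\<lambda>(i, d). (i, i + d + of_bool t))"

lemma inj_coord: "inj (coord t)"
  by (auto simp: inj_def coord_def)

lemma coord_image_iff: "(i, j) \<in> coord t ` D \<longleftrightarrow> i + of_bool t \<le> j \<and> (i, j - i - of_bool t) \<in> D"
  by (force simp: coord_def image_iff)

lemma diagram_B_eq: 
  assumes "strict_partition lam" shows "diagram_B lam = coord False ` cells (set lam)"
proof (rule set_eqI, clarify)
  fix i j
  \<comment> \<open>\<open>strict_part\<close> is 0 beyond the length, so a nonempty row lies within
    it.\<close>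
  have "i \<le> length lam" if "d < strict_part lam i" for d
    using that by (auto simp: strict_part_def split: if_splits)
  then have "i \<ge> 1 \<Longrightarrow> i \<le> length lam \<and> i \<le> j \<and> j \<le> strict_part lam i + i - 1 \<longleftrightarrow>
      i \<le> j \<and> j - i < strict_part lam i" by fastforce
  then show "(i, j) \<in> diagram_B lam \<longleftrightarrow> (i, j) \<in> coord False ` cells (set lam)"
    using strict_part_gt[OF assms] unfolding coord_image_iff
    by (auto simp: diagram_B_def cells_def)
qed

lemma diagram_D_eq: 
  assumes "strict_partition lam" shows "diagram_D lam = coord True ` cells (set lam)"
proof (rule set_eqI, clarify)
  fix i j
  have "i \<le> length lam" if "d < strict_part lam i" for d
    using that by (auto simp: strict_part_def split: if_splits)
  then have "i \<ge> 1 \<Longrightarrow> i \<le> length lam \<and> i < j \<and> j \<le> strict_part lam i + i \<longleftrightarrow>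
      i + 1 \<le> j \<and> j - i - 1 < strict_part lam i" by fastforce
  then show "(i, j) \<in> diagram_D lam \<longleftrightarrow> (i, j) \<in> coord True ` cells (set lam)"
    using strict_part_gt[OF assms] unfolding coord_image_iff
    by (auto simp: diagram_D_def cells_def)
qed

section \<open>Translation of excited moves\<close>

lemma subshape_iff:
  "strict_partition mu \<Longrightarrow> strict_partition lam \<Longrightarrow> subshape mu lam \<longleftrightarrow> cells (set mu) \<subseteq> cells (set lam)"
  by (simp add: subshape_def diagram_B_eq inj_image_subset_iff inj_coord)

lemma excited_move_B_iff:
  assumes "strict_partition lam"
  shows "excited_move_B lam (coord False ` D) E \<longleftrightarrow>
    (\<exists>D'. move False (cells (set lam)) D D' \<and> E = coord False ` D')"
proof -
  let ?f = "coord False"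
  have im: "?f ` D - {?f c} \<union> {?f c'} = ?f ` insert c' (D - {c})" for c c'
    using image_set_diff[OF inj_coord, of False D "{c}"] by auto
  have ex: "(\<exists>i j. (i, j) \<in> ?f ` D \<and> P i j) \<longleftrightarrow> (\<exists>i d. (i, d) \<in> D \<and> P i (i + d))" for P
  proof
    assume "\<exists>i d. (i, d) \<in> D \<and> P i (i + d)"
    then obtain i d where "(i, d) \<in> D" "P i (i + d)" by blast
    then show "\<exists>i j. (i, j) \<in> ?f ` D \<and> P i j"
      by (intro exI[of _ i] exI[of _ "i + d"]) (simp add: coord_image_iff)
  qed (auto simp: coord_def)
  have "excited_move_B lam (?f ` D) E \<longleftrightarrow> D \<subseteq> cells (set lam) \<and>
    (\<exists>i d. (i, d) \<in> D \<and> (i + 1, i + d + 1) \<in> ?f ` cells (set lam) \<and>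
        (i + 1, i + d) \<notin> ?f ` D \<and> (i, i + d + 1) \<notin> ?f ` D \<and> (i + 1, i + d + 1) \<notin> ?f ` D \<and>
        E = ?f ` D - {?f (i, d)} \<union> {?f (i + 1, d)})"
    unfolding excited_move_B_def diagram_B_eq[OF assms] inj_image_subset_iff[OF inj_coord] ex
    by (simp add: coord_def)
  also have "\<dots> \<longleftrightarrow> D \<subseteq> cells (set lam) \<and>
    (\<exists>i d. (i, d) \<in> D \<and> next_cell False (i, d) \<in> cells (set lam) \<and> blockers False (i, d) \<inter> D = {} \<and>
        E = ?f ` insert (next_cell False (i, d)) (D - {(i, d)}))"
  proof -
    have "(i + 1, i + d + 1) \<in> ?f ` cells (set lam) \<and>
        (i + 1, i + d) \<notin> ?f ` D \<and> (i, i + d + 1) \<notin> ?f ` D \<and> (i + 1, i + d + 1) \<notin> ?f ` D \<longleftrightarrow>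
       next_cell False (i, d) \<in> cells (set lam) \<and> blockers False (i, d) \<inter> D = {}" for i d
      by (cases d) (auto simp: coord_image_iff next_cell_def blockers_def)
    moreover have "?f ` D - {?f (i, d)} \<union> {?f (i + 1, d)} = ?f ` insert (next_cell False (i, d)) (D - {(i, d)})" for i d
      unfolding im by (simp add: next_cell_def)
    ultimately have "(i, d) \<in> D \<and> (i + 1, i + d + 1) \<in> ?f ` cells (set lam) \<and>
        (i + 1, i + d) \<notin> ?f ` D \<and> (i, i + d + 1) \<notin> ?f ` D \<and> (i + 1, i + d + 1) \<notin> ?f ` D \<and>
        E = ?f ` D - {?f (i, d)} \<union> {?f (i + 1, d)} \<longleftrightarrow>
      (i, d) \<in> D \<and> next_cell False (i, d) \<in> cells (set lam) \<and> blockers False (i, d) \<inter> D = {} \<and>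
        E = ?f ` insert (next_cell False (i, d)) (D - {(i, d)})" for i d
      by metis
    then show ?thesis by (simp only:)
  qed
  finally show ?thesis unfolding move_def by auto
qed

text \<open>The condition \<open>i + 1 < j\<close> says that the content is positive, so the two
  kinds of moves are the two cases of \<open>next_cell\<close>. By \<open>blockers_subset\<close>,
  all blockers lie in the diagram once the target does.\<close>

lemma excited_move_D_iff:
  assumes "strict_partition lam"
  shows "excited_move_D lam (coord True ` D) E \<longleftrightarrow>
    (\<exists>D'. move True (cells (set lam)) D D' \<and> E = coord True ` D')"
proof -
  let ?f = "coord True" and ?L = "cells (set lam)"
  have im: "?f ` D - {?f c} \<union> {?f c'} = ?f ` insert c' (D - {c})" for c c'
    using image_set_diff[OF inj_coord, of True D "{c}"] by auto
  have diff: "?f ` ?L - ?f ` D = ?f ` (?L - D)" by (rule image_set_diff[OF inj_coord, symmetric])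
  have bl: "blockers True c \<subseteq> ?L - D \<longleftrightarrow> next_cell True c \<in> ?L \<and> blockers True c \<inter> D = {}"
    if "c \<in> D" "D \<subseteq> ?L" for c
    using blockers_subset[OF shape_set[OF assms], of True c] that next_cell_blocker[of True c] by blast
  have "excited_move_D lam (?f ` D) E \<longleftrightarrow> D \<subseteq> ?L \<and>
    (\<exists>c\<in>D. ?f ` blockers True c \<subseteq> ?f ` (?L - D) \<and>
        E = ?f ` insert (next_cell True c) (D - {c}))" (is "_ \<longleftrightarrow> _ \<and> ?R")
  proof -
    have "(\<exists>i j. (i, j) \<in> ?f ` D \<and> i + 1 < j \<and>
         {(i + 1, j), (i, j + 1), (i + 1, j + 1)} \<subseteq> ?f ` (?L - D) \<and>
         E = (?f ` D - {(i, j)}) \<union> {(i + 1, j + 1)}) \<longleftrightarrow>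
       (\<exists>i d. (i, Suc d) \<in> D \<and> ?f ` blockers True (i, Suc d) \<subseteq> ?f ` (?L - D) \<and>
         E = ?f ` insert (next_cell True (i, Suc d)) (D - {(i, Suc d)}))" (is "?A1 \<longleftrightarrow> ?A2")
    proof -
      have *: "?f (i, Suc d) = (i, i + d + 2)" "?f (next_cell True (i, Suc d)) = (i + 1, i + d + 3)"
        "?f ` blockers True (i, Suc d) = {(i + 1, i + d + 2), (i, i + d + 3), (i + 1, i + d + 3)}" for i d
        by (auto simp: coord_def next_cell_def blockers_def)
      have ex: "(\<exists>i j. (i, j) \<in> ?f ` D \<and> i + 1 < j \<and> P i j) \<longleftrightarrow> (\<exists>i d. (i, Suc d) \<in> D \<and> P i (i + d + 2))" for P
      proof
        assume "\<exists>i j. (i, j) \<in> ?f ` D \<and> i + 1 < j \<and> P i j"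
        then obtain i j where ij: "(i, j) \<in> ?f ` D" "i + 1 < j" "P i j" by blast
        then obtain d where d: "(i, d) \<in> D" "j = i + d + 1" by (auto simp: coord_def)
        then obtain d' where "d = Suc d'" using ij(2) by (cases d) auto
        then show "\<exists>i d. (i, Suc d) \<in> D \<and> P i (i + d + 2)" using d ij by auto
      next
        assume "\<exists>i d. (i, Suc d) \<in> D \<and> P i (i + d + 2)"
        then obtain i d where "(i, Suc d) \<in> D" "P i (i + d + 2)" by blast
        then show "\<exists>i j. (i, j) \<in> ?f ` D \<and> i + 1 < j \<and> P i j"
          by (intro exI[of _ i] exI[of _ "i + d + 2"]) (simp add: coord_image_iff)
      qed
      show ?thesis unfolding ex im[symmetric] * by (simp add: numeral_eq_Suc)
    qed
    moreover have "(\<exists>i. (i, i + 1) \<in> ?f ` D \<and>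
         {(i, i + 2), (i, i + 3), (i + 1, i + 2), (i + 1, i + 3), (i + 2, i + 3)} \<subseteq> ?f ` (?L - D) \<and>
         E = (?f ` D - {(i, i + 1)}) \<union> {(i + 2, i + 3)}) \<longleftrightarrow>
       (\<exists>i. (i, 0) \<in> D \<and> ?f ` blockers True (i, 0) \<subseteq> ?f ` (?L - D) \<and>
         E = ?f ` insert (next_cell True (i, 0)) (D - {(i, 0)}))" (is "?B1 \<longleftrightarrow> ?B2")
    proof -
      have *: "?f (i, 0) = (i, i + 1)" "?f (next_cell True (i, 0)) = (i + 2, i + 3)"
        "?f ` blockers True (i, 0) = {(i, i + 2), (i, i + 3), (i + 1, i + 2), (i + 1, i + 3), (i + 2, i + 3)}" for i
        by (auto simp: coord_def next_cell_def blockers_def)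
      have "(i, i + 1) \<in> ?f ` D \<longleftrightarrow> (i, 0) \<in> D" for i by (simp add: coord_image_iff)
      then show ?thesis unfolding im[symmetric] * by simp
    qed
    moreover have "?A2 \<or> ?B2 \<longleftrightarrow> ?R"
    proof
      assume ?R
      then obtain i d where "(i, d) \<in> D" "?f ` blockers True (i, d) \<subseteq> ?f ` (?L - D)"
        "E = ?f ` insert (next_cell True (i, d)) (D - {(i, d)})" by fast
      then show "?A2 \<or> ?B2" by (cases d) blast+
    qed blast
    ultimately show ?thesis
      unfolding excited_move_D_def diagram_D_eq[OF assms] inj_image_subset_iff[OF inj_coord] diff by argo
  qed
  also have "\<dots> \<longleftrightarrow> (\<exists>D'. move True ?L D D' \<and> E = ?f ` D')"
  proof -
    have "(\<exists>D'. move True ?L D D' \<and> E = ?f ` D') \<longleftrightarrow> D \<subseteq> ?L \<and> (\<exists>c\<in>D. next_cell True c \<in> ?L \<and>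
        blockers True c \<inter> D = {} \<and> E = ?f ` insert (next_cell True c) (D - {c}))"
      unfolding move_def by blast
    then show ?thesis unfolding inj_image_subset_iff[OF inj_coord]
      by (cases "D \<subseteq> ?L") (simp_all add: bl conj_assoc del: image_insert cong: bex_cong)
  qed
  finally show ?thesis .
qed

text \<open>Steps of \<open>R\<close> from the image of \<open>f\<close> stay in the image and lift
  to \<open>Q\<close>, so whole paths do.\<close>

lemma rtranclp_image:
  assumes "\<And>a y. R (f a) y \<longleftrightarrow> (\<exists>b. Q a b \<and> y = f b)"
  shows "R\<^sup>*\<^sup>* (f a) y \<longleftrightarrow> (\<exists>b. Q\<^sup>*\<^sup>* a b \<and> y = f b)"
proof
  assume "R\<^sup>*\<^sup>* (f a) y"
  then show "\<exists>b. Q\<^sup>*\<^sup>* a b \<and> y = f b"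
  proof (induction rule: rtranclp_induct)
    case (step y z)
    then show ?case using assms by (metis rtranclp.rtrancl_into_rtrancl)
  qed blast
next
  assume "\<exists>b. Q\<^sup>*\<^sup>* a b \<and> y = f b"
  then obtain b where "Q\<^sup>*\<^sup>* a b" "y = f b" by blast
  from this(1) have "R\<^sup>*\<^sup>* (f a) (f b)"
    by (induction rule: rtranclp_induct) (use assms in \<open>auto intro: rtranclp.rtrancl_into_rtrancl\<close>)
  then show "R\<^sup>*\<^sup>* (f a) y" using \<open>y = f b\<close> by simp
qed

lemma excited_B_eq:
  assumes "strict_partition lam" "strict_partition mu" "reading w (set lam)"
  shows "excited_B lam mu = image (coord False) ` subwords False w (set mu)"
  unfolding reachable_eq_subwords[OF assms(3) shape_set[OF assms(2)], symmetric]
    excited_B_def subshape_iff[OF assms(2,1)] diagram_B_eq[OF assms(2)]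
  using rtranclp_image[of "excited_move_B lam" "image (coord False)", OF excited_move_B_iff[OF assms(1)]]
  by auto

lemma excited_D_eq:
  assumes "strict_partition lam" "strict_partition mu" "reading w (set lam)"
  shows "excited_D lam mu = image (coord True) ` subwords True w (set mu)"
  unfolding reachable_eq_subwords[OF assms(3) shape_set[OF assms(2)], symmetric]
    excited_D_def subshape_iff[OF assms(2,1)] diagram_D_eq[OF assms(2)]
  using rtranclp_image[of "excited_move_D lam" "image (coord True)", OF excited_move_D_iff[OF assms(1)]]
  by auto

section \<open>Weights and sums in row and column coordinates\<close>

lemma weight_D_coord: "weight_D (coord True ` D) = (\<Prod>c\<in>D. cell_weight True Xvar c)"
  unfolding weight_D_def
  by (subst prod.reindex[OF inj_on_subset[OF inj_coord subset_UNIV]])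
    (auto intro!: prod.cong simp: coord_def cell_weight_def)

lemma weight_B_coord:
  assumes "finite D" shows "weight_B (coord False ` D) = (\<Prod>c\<in>D. cell_weight False Xvar c)"
proof -
  let ?f = "coord False"
  let ?D0 = "{c \<in> D. snd c = 0}" and ?D1 = "{c \<in> D. snd c > 0}"
  have "{i. (i, i) \<in> ?f ` D} = fst ` ?D0"
  proof (rule set_eqI)
    fix i
    have "i \<in> fst ` ?D0 \<longleftrightarrow> (i, 0) \<in> D" by force
    then show "i \<in> {i. (i, i) \<in> ?f ` D} \<longleftrightarrow> i \<in> fst ` ?D0" by (simp add: coord_image_iff)
  qed
  then have "(\<Prod>i | (i, i) \<in> ?f ` D. Xvar i) = (\<Prod>c\<in>?D0. cell_weight False Xvar c)"
    by (simp, subst prod.reindex) (auto intro!: prod.cong inj_onI simp: cell_weight_def)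
  moreover have "{(i, j). (i, j) \<in> ?f ` D \<and> i < j} = ?f ` ?D1"
    by (rule set_eqI, clarify) (auto simp: coord_image_iff)
  then have "(\<Prod>(i, j) | (i, j) \<in> ?f ` D \<and> i < j. Xvar i + Xvar j) = (\<Prod>c\<in>?D1. cell_weight False Xvar c)"
    by (simp, subst prod.reindex[OF inj_on_subset[OF inj_coord subset_UNIV]])
      (auto intro!: prod.cong simp: cell_weight_def coord_def)
  moreover have "(\<Prod>c\<in>D. cell_weight False Xvar c) = (\<Prod>c\<in>?D0 \<union> ?D1. cell_weight False Xvar c)"
    by (rule prod.cong) auto
  moreover have "\<dots> = (\<Prod>c\<in>?D0. cell_weight False Xvar c) * (\<Prod>c\<in>?D1. cell_weight False Xvar c)"
    by (rule prod.union_disjoint) (use assms in auto)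
  ultimately show ?thesis by (simp add: weight_B_def)
qed

lemma inj_image_coord: "inj_on (image (coord t)) A"
  by (rule inj_onI) (simp add: inj_image_eq_iff[OF inj_coord])

lemma excited_sum_B:
  assumes "strict_partition lam" "strict_partition mu" "reading w (set lam)"
  shows "(\<Sum>D\<in>excited_B lam mu. weight_B D) = excited_sum False Xvar w (set mu)"
  unfolding excited_B_eq[OF assms] excited_sum_def
  by (subst sum.reindex[OF inj_image_coord])
    (auto intro!: sum.cong weight_B_coord dest: subwords_subset intro: finite_subset)

lemma excited_sum_D:
  assumes "strict_partition lam" "strict_partition mu" "reading w (set lam)"
  shows "(\<Sum>D\<in>excited_D lam mu. weight_D D) = excited_sum True Xvar w (set mu)"
  unfolding excited_D_eq[OF assms] excited_sum_def
  by (subst sum.reindex[OF inj_image_coord]) (simp add: weight_D_coord)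

section \<open>Covers as added corners\<close>

lemma card_cells: "shape S \<Longrightarrow> card (cells S) = \<Sum>S"
  and sum_add: "shape S \<Longrightarrow> addable e S \<Longrightarrow> \<Sum>(add_corner e S) = Suc (\<Sum>S)"
proof -
  have sum_add: "\<Sum>(add_corner e S) = Suc (\<Sum>S)" if "shape S" "addable e S" for e S
  proof -
    have fin: "finite S" using that by (simp add: shape_def)
    have "\<Sum>(add_corner e S) = Suc e + \<Sum>(S - {e})" using that fin by (simp add: add_corner_def addable_def)
    also have "\<dots> = Suc (\<Sum>S)" using that fin by (auto simp: addable_def shape_def sum.remove)
    finally show ?thesis .
  qed
  {
    assume "shape S"
    then obtain w where "reading w S" using ex_reading by blast
    then show "card (cells S) = \<Sum>S"
    proof (induction rule: reading.induct)
      case (Cons w S e)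
      have "(Suc (cnt S e), e) \<notin> cells S" by (auto simp: cells_def)
      then show ?case using Cons finite_cells[OF Cons.hyps(1)] sum_add[OF reading_shape[OF Cons.hyps(1)]]
        by (simp add: cells_add reading_shape[OF Cons.hyps(1)])
    qed simp
  }
  show "shape S \<Longrightarrow> addable e S \<Longrightarrow> \<Sum>(add_corner e S) = Suc (\<Sum>S)" by (rule sum_add)
qed

text \<open>Just one cell is new, so a single diagonal \<open>d\<close> grows, by one. Lengths drop
  by 0 or 1 per step in both shapes, which forces \<open>d + 1\<close> not to be a part of
  \<open>M\<close> and \<open>d\<close> to be 0 or a part.\<close>

lemma cover_iff:
  assumes M: "shape M" and N: "shape N"
  shows "cells M \<subseteq> cells N \<and> \<Sum>N = Suc (\<Sum>M) \<longleftrightarrow> (\<exists>e. addable e M \<and> N = add_corner e M)"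
proof
  assume a: "cells M \<subseteq> cells N \<and> \<Sum>N = Suc (\<Sum>M)"
  obtain w w' where "reading w M" "reading w' N" using ex_reading M N by blast
  then have fin: "finite (cells M)" "finite (cells N)" using finite_cells by auto
  have "card (cells N - cells M) = 1"
    using a fin by (simp add: card_Diff_subset card_cells M N)
  then obtain i d where c: "cells N - cells M = {(i, d)}" by (metis card_1_singletonE surj_pair)
  have le: "cnt M f \<le> cnt N f" for f using a by (simp add: cells_subset_iff)
  have new: "k = i \<and> f = d" if "cnt M f < k" "k \<le> cnt N f" for k f
  proof -
    have "(k, f) \<in> cells N - cells M" using that by (auto simp: cells_def)
    then show ?thesis using c by auto
  qed
  have "(i, d) \<in> cells N - cells M" using c by auto
  then have i: "cnt M d < i" "i \<le> cnt N d" by (auto simp: cells_def)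
  then have d: "cnt N d = Suc (cnt M d)"
    using new[of d "cnt N d"] new[of d "cnt N d - 1"] by linarith
  have eq: "cnt N f = cnt M f + of_bool (f = d)" for f
    using new[of f "cnt N f"] le[of f] d by (cases "f = d") (simp, force simp: not_less)
  have finM: "finite M" "finite N" using M N by (auto simp: shape_def)
  have "Suc d \<notin> M"
    using cnt_Suc[OF finM(1), of d] cnt_Suc[OF finM(2), of d] eq[of d] eq[of "Suc d"]
    by (cases "Suc d \<in> N") auto
  moreover have "d = 0 \<or> d \<in> M"
  proof (cases d)
    case (Suc f)
    then show ?thesis
      using cnt_Suc[OF finM(1), of f] cnt_Suc[OF finM(2), of f] eq[of f] eq[of d]
      by (cases "Suc f \<in> M") auto
  qed simp
  ultimately have add: "addable d M" by (simp add: addable_def)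
  moreover have "N = add_corner d M" by (rule shape_eqI) (use M N eq cnt_add[OF M add] in auto)
  ultimately show "\<exists>e. addable e M \<and> N = add_corner e M" by blast
next
  assume "\<exists>e. addable e M \<and> N = add_corner e M"
  then show "cells M \<subseteq> cells N \<and> \<Sum>N = Suc (\<Sum>M)" using M sum_add[OF M] cells_add[OF M] by auto
qed

lemma sum_list_strict_partition: "strict_partition lam \<Longrightarrow> sum_list lam = \<Sum>(set lam)"
  by (simp add: distinct_sum_list_conv_Sum distinct_strict_partition)

lemma covered_by_iff:
  assumes "strict_partition mu" "strict_partition nu"
  shows "covered_by mu nu \<longleftrightarrow> (\<exists>e. addable e (set mu) \<and> set nu = add_corner e (set mu))"
  unfolding covered_by_def subshape_iff[OF assms] sum_list_strict_partition[OF assms(1)]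
    sum_list_strict_partition[OF assms(2)] cover_iff[OF shape_set[OF assms(1)] shape_set[OF assms(2)], symmetric]
  by simp

lemma inj_on_set_strict_partition: "inj_on set {nu. strict_partition nu \<and> P nu}"
proof (rule inj_onI)
  fix xs ys :: "nat list"
  assume "xs \<in> {nu. strict_partition nu \<and> P nu}" "ys \<in> {nu. strict_partition nu \<and> P nu}" "set xs = set ys"
  then have "rev xs = rev ys"
    by (intro strict_sorted_equal) (auto simp: strict_partition_def sorted_wrt_rev)
  then show "xs = ys" by simp
qed

lemma ex_strict_partition:
  assumes "shape S" obtains nu where "strict_partition nu" "set nu = S"
proof
  have fin: "finite S" using assms by (simp add: shape_def)
  show "set (rev (sorted_list_of_set S)) = S" using fin by simp
  show "strict_partition (rev (sorted_list_of_set S))"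
    using assms fin strict_sorted_list_of_set[of S]
    by (auto simp: strict_partition_def sorted_wrt_rev shape_def intro: gr0I)
qed

lemma add_inj: "shape M \<Longrightarrow> addable e M \<Longrightarrow> addable f M \<Longrightarrow> add_corner e M = add_corner f M \<Longrightarrow> e = f"
  using cnt_add[of M e e] cnt_add[of M f e] by (cases "e = f") auto

text \<open>A cover that does not fit into \<open>lam\<close> has no subword, so its sum is 0 and
  all corners of \<open>mu\<close> may be summed over.\<close>

lemma sum_covers:
  assumes "strict_partition lam" "strict_partition mu" "reading w (set lam)"
  shows "(\<Sum>nu | strict_partition nu \<and> covered_by mu nu \<and> subshape nu lam. excited_sum t x w (set nu)) =
    (\<Sum>e | addable e (set mu). excited_sum t x w (add_corner e (set mu)))"
proof -
  let ?M = "set mu"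
  have M: "shape ?M" using assms(2) by (rule shape_set)
  let ?C = "{nu. strict_partition nu \<and> covered_by mu nu \<and> subshape nu lam}"
  have "(\<Sum>nu\<in>?C. excited_sum t x w (set nu)) = (\<Sum>N\<in>set ` ?C. excited_sum t x w N)"
    by (subst sum.reindex[OF inj_on_set_strict_partition]) simp
  also have "\<dots> = (\<Sum>N\<in>(\<lambda>e. add_corner e ?M) ` {e. addable e ?M}. excited_sum t x w N)"
  proof (rule sum.mono_neutral_left)
    show "finite ((\<lambda>e. add_corner e ?M) ` {e. addable e ?M})" using finite_addable[OF M] by simp
    show "set ` ?C \<subseteq> (\<lambda>e. add_corner e ?M) ` {e. addable e ?M}"
      using covered_by_iff[OF assms(2)] by auto
    show "\<forall>N\<in>(\<lambda>e. add_corner e ?M) ` {e. addable e ?M} - set ` ?C. excited_sum t x w N = 0"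
    proof
      fix N assume N: "N \<in> (\<lambda>e. add_corner e ?M) ` {e. addable e ?M} - set ` ?C"
      then have sN: "shape N" using M by auto
      then obtain nu where nu: "strict_partition nu" "set nu = N" using ex_strict_partition by blast
      have "covered_by mu nu" using covered_by_iff[OF assms(2) nu(1)] nu N by auto
      then have "\<not> subshape nu lam" using N nu by auto
      then have "subwords t w N = {}"
        using reachable_eq_subwords[OF assms(3) sN, of t] subshape_iff[OF nu(1) assms(1)] nu by auto
      then show "excited_sum t x w N = 0" by (simp add: excited_sum_def)
    qed
  qed
  also have "\<dots> = (\<Sum>e | addable e ?M. excited_sum t x w (add_corner e ?M))"
    by (subst sum.reindex) (auto intro!: inj_onI add_inj[OF M])
  finally show ?thesis .
qed

section \<open>The index sets of the linear factors\<close>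

lemma initial_segment:
  assumes "finite A" "\<And>r. r \<in> A \<Longrightarrow> 1 \<le> r" "\<And>r s. r \<in> A \<Longrightarrow> 1 \<le> s \<Longrightarrow> s \<le> r \<Longrightarrow> s \<in> A" "1 \<le> r"
  shows "r \<le> card A \<longleftrightarrow> r \<in> A"
proof (cases "A = {}")
  case False
  have eq: "A = {1..Max A}"
  proof
    show "A \<subseteq> {1..Max A}" using assms(1,2) by auto
    show "{1..Max A} \<subseteq> A" using assms(3)[OF Max_in[OF assms(1) False]] by auto
  qed
  have "card A = Max A" using arg_cong[OF eq, of card] by simp
  moreover have "r \<in> A \<longleftrightarrow> r \<in> {1..Max A}" using eq by blast
  ultimately show ?thesis using assms(4) by simp
qed (use assms in auto)

text \<open>A nonempty column starts in row 1 and has no holes, so a single cell tests its length;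
  \<open>r \<le> i\<close> keeps \<open>i - r\<close> from truncating.\<close>

lemma col_len_iff:
  assumes "strict_partition mu" "1 \<le> r"
  shows "r \<le> col_len mu i \<longleftrightarrow> r \<le> i \<and> r \<le> cnt (set mu) (i - r)"
proof -
  have mem: "(s, i) \<in> diagram_B mu \<longleftrightarrow> 1 \<le> s \<and> s \<le> i \<and> (s, i - s) \<in> cells (set mu)" for s
    unfolding diagram_B_eq[OF assms(1)] coord_image_iff by (auto simp: cells_def)
  have "r \<le> col_len mu i \<longleftrightarrow> r \<in> {s. (s, i) \<in> diagram_B mu}"
    unfolding col_len_def
  proof (rule initial_segment)
    show "finite {s. (s, i) \<in> diagram_B mu}"
      by (rule finite_subset[of _ "{..i}"]) (auto simp: mem)
  qed (use assms cells_down[OF shape_set[OF assms(1)]] in \<open>auto simp: mem\<close>)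
  then show ?thesis using assms(2) by (simp add: mem cells_def)
qed

text \<open>With \<open>c\<close> the column length, row \<open>c\<close> meets the column, so at
  least \<open>c\<close> parts exceed \<open>i - c\<close>; row \<open>c + 1\<close> misses it, so
  at most \<open>c\<close> parts exceed \<open>i - c - 1\<close>. This leaves no room for a part
  \<open>i - c\<close>.\<close>

lemma gap_of_column:
  assumes "strict_partition mu" "col_len mu i < i"
  shows "i - col_len mu i \<notin> set mu" "cnt (set mu) (i - col_len mu i) = col_len mu i"
proof -
  let ?c = "col_len mu i"
  define g where "g = i - Suc ?c"
  have g: "i - ?c = Suc g" using assms(2) by (simp add: g_def)
  have 1: "?c \<le> cnt (set mu) (Suc g)" 
    using col_len_iff[OF assms(1), of ?c i] g by (cases "?c = 0") auto
  have 2: "cnt (set mu) g \<le> ?c"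
    using col_len_iff[OF assms(1), of "Suc ?c" i] assms(2) by (simp add: g_def)
  have 3: "cnt (set mu) g = cnt (set mu) (Suc g) + of_bool (Suc g \<in> set mu)" by (rule cnt_Suc) simp
  have "Suc g \<notin> set mu" using 1 2 3 by (cases "Suc g \<in> set mu") auto
  then show "i - ?c \<notin> set mu" unfolding g .
  show "cnt (set mu) (i - ?c) = ?c" unfolding g using 1 2 3 by linarith
qed

lemma col_len_gap:
  assumes "strict_partition mu" "a > 0" "a \<notin> set mu"
  shows "col_len mu (a + cnt (set mu) a) = cnt (set mu) a"
proof -
  let ?c = "cnt (set mu) a"
  obtain b where b: "a = Suc b" using assms(2) by (cases a) auto
  have "cnt (set mu) b = ?c" using cnt_Suc[of "set mu" b] assms(3) b by simp
  then have "\<not> Suc ?c \<le> col_len mu (a + ?c)"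
    using col_len_iff[OF assms(1), of "Suc ?c" "a + ?c"] b by simp
  moreover have "?c \<le> col_len mu (a + ?c)"
    using col_len_iff[OF assms(1), of ?c "a + ?c"] by (cases "?c = 0") auto
  ultimately show ?thesis by simp
qed

text \<open>At most \<open>a - 1\<close> parts are smaller than the gap \<open>a\<close>.\<close>

lemma length_lt_gap:
  assumes "strict_partition lam" "a > 0" "a \<notin> set lam"
  shows "length lam < a + cnt (set lam) a"
proof -
  obtain b where b: "a = Suc b" using assms(2) by (cases a) auto
  have "length lam = cnt (set lam) 0"
    using distinct_card[OF distinct_strict_partition[OF assms(1)]] cnt_0[OF shape_set[OF assms(1)]] by simp
  also have "\<dots> \<le> cnt (set lam) b + b" using cnt_slope[of "set lam" 0 b] by simp
  also have "cnt (set lam) b = cnt (set lam) a" using cnt_Suc[of "set lam" b] assms(3) b by simp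
  finally show ?thesis using b by simp
qed

text \<open>There are fewer than \<open>k\<close> rows, so column \<open>k\<close> ends before the
  diagonal and \<open>g = k - col_len lam k\<close> is a gap of \<open>lam\<close>. The positive
  values of \<open>i - col_len mu i\<close> are the gaps of \<open>mu\<close>, so the condition says
  that \<open>g\<close> is a part of \<open>mu\<close>.\<close>

lemma column_condition_iff:
  assumes lam: "strict_partition lam" and mu: "strict_partition mu" and k: "length lam < k"
  shows "(\<forall>i\<ge>1. int (col_len lam k) - int k \<noteq> int (col_len mu i) - int i) \<longleftrightarrow>
    (\<exists>a>0. a \<notin> set lam \<and> a \<in> set mu \<and> k = a + cnt (set lam) a)" (is "?L \<longleftrightarrow> ?R")
proof -
  let ?c = "col_len lam k"
  have "?c \<le> cnt (set lam) (k - ?c)" using col_len_iff[OF lam, of ?c k] by (cases "?c = 0") auto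
  then have c: "?c < k" using cnt_le_length[of lam "k - ?c"] k by simp
  define g where "g = k - ?c"
  have g: "g > 0" "g \<notin> set lam" "cnt (set lam) g = ?c" "k = g + ?c"
    using gap_of_column[OF lam c] c by (auto simp: g_def)
  have R: "?R \<longleftrightarrow> g \<in> set mu"
  proof
    assume ?R
    then obtain a where a: "a > 0" "a \<notin> set lam" "a \<in> set mu" "k = a + cnt (set lam) a" by blast
    then have "?c = cnt (set lam) a" using col_len_gap[OF lam a(1,2)] by metis
    then have "g = a" using a(4) g(4) by linarith
    then show "g \<in> set mu" using a(3) by simp
  qed (use g in auto)
  have int: "int ?c - int k = - int g" using g(4) by simp
  show ?thesis unfolding R int
  proof
    assume L: "\<forall>i\<ge>1. - int g \<noteq> int (col_len mu i) - int i"
    show "g \<in> set mu"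
    proof (rule ccontr)
      assume "g \<notin> set mu"
      then have "col_len mu (g + cnt (set mu) g) = cnt (set mu) g" using col_len_gap[OF mu g(1)] by simp
      then show False using L[rule_format, of "g + cnt (set mu) g"] g(1) by simp
    qed
  next
    assume gmu: "g \<in> set mu"
    show "\<forall>i\<ge>1. - int g \<noteq> int (col_len mu i) - int i"
    proof (intro allI impI notI)
      fix i assume "- int g = int (col_len mu i) - int i"
      then have "i - col_len mu i = g" "col_len mu i < i" using g(1) by linarith+
      then show False using gap_of_column(1)[OF mu, of i] gmu by simp
    qed
  qed
qed

lemma row_condition_iff:
  assumes lam: "strict_partition lam" and mu: "strict_partition mu"
  shows "1 \<le> k \<and> k \<le> length lam \<and> (\<forall>i\<ge>1. strict_part lam k \<noteq> strict_part mu i) \<longleftrightarrow>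
    (\<exists>a\<in>set lam. a \<notin> set mu \<and> k = Suc (cnt (set lam) a))"
proof -
  have part: "strict_part l k \<in> set l" if "1 \<le> k" "k \<le> length l" for l :: "nat list" and k
    using that by (simp add: strict_part_def)
  have ex: "\<exists>k. 1 \<le> k \<and> k \<le> length l \<and> strict_part l k = a" if a: "a \<in> set l" for l :: "nat list" and a
  proof -
    obtain n where "n < length l" "l ! n = a" using a by (auto simp: in_set_conv_nth)
    then show ?thesis by (intro exI[of _ "Suc n"]) (simp add: strict_part_def)
  qed
  have pos: "0 \<notin> set lam" using shape_set[OF lam] by (simp add: shape_def)
  have index: "Suc (cnt (set lam) (strict_part lam k)) = k" if k: "1 \<le> k" "k \<le> length lam" for k
  proof -
    have "strict_part lam k \<noteq> 0" using part[OF k] pos by metis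
    then obtain b where b: "strict_part lam k = Suc b" using not0_implies_Suc by blast
    have "k \<le> cnt (set lam) b" using strict_part_gt[OF lam k(1), of b] b by simp
    moreover have "\<not> k \<le> cnt (set lam) (Suc b)" using strict_part_gt[OF lam k(1), of "Suc b"] b by simp
    moreover have "cnt (set lam) b = Suc (cnt (set lam) (Suc b))"
      using cnt_Suc[of "set lam" b] part[OF k] b by simp
    ultimately show ?thesis using b by simp
  qed
  \<comment> \<open>Beyond the length \<open>strict_part mu i\<close> is 0, which never equals a
    part of \<open>lam\<close>.\<close>
  have mem: "(\<forall>i\<ge>1. a \<noteq> strict_part mu i) \<longleftrightarrow> a \<notin> set mu" if "a \<in> set lam" for a
  proof -
    have "a \<noteq> 0" using that pos by metis
    then show ?thesis using ex[of a mu] part[of _ mu] by (metis strict_part_def)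
  qed
  show ?thesis
  proof
    assume "1 \<le> k \<and> k \<le> length lam \<and> (\<forall>i\<ge>1. strict_part lam k \<noteq> strict_part mu i)"
    then show "\<exists>a\<in>set lam. a \<notin> set mu \<and> k = Suc (cnt (set lam) a)"
      using part[of k lam] mem index[of k] by (intro bexI[of _ "strict_part lam k"]) auto
  next
    assume "\<exists>a\<in>set lam. a \<notin> set mu \<and> k = Suc (cnt (set lam) a)"
    then obtain a where a: "a \<in> set lam" "a \<notin> set mu" "k = Suc (cnt (set lam) a)" by blast
    obtain k' where k': "1 \<le> k'" "k' \<le> length lam" "strict_part lam k' = a" using ex[OF a(1)] by blast
    then have "k' = k" using index[OF k'(1,2)] a(3) by simp
    then show "1 \<le> k \<and> k \<le> length lam \<and> (\<forall>i\<ge>1. strict_part lam k \<noteq> strict_part mu i)"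
      using k' mem[OF a(1)] a by auto
  qed
qed

lemma card_strict_partition: "strict_partition lam \<Longrightarrow> card (set lam) = length lam"
  by (simp add: distinct_card distinct_strict_partition)

lemma cnt_less_length:
  "strict_partition lam \<Longrightarrow> a \<in> set lam \<Longrightarrow> cnt (set lam) a < length lam"
  unfolding cnt_def card_strict_partition[symmetric] by (rule psubset_card_mono) auto

text \<open>Positions of parts are at most \<open>length lam\<close> and decrease with the part;
  positions of gaps exceed \<open>length lam\<close> and increase with the gap. In type B the number
  0 would get position \<open>length lam\<close>, hence its exclusion.\<close>

lemma inj_position:
  assumes "strict_partition lam" "\<And>a. a \<in> A \<Longrightarrow> t \<or> a > 0"
  shows "inj_on (position t (set lam)) A"
proof (rule linorder_inj_onI')
  let ?S = "set lam"
  fix a b assume ab: "a \<in> A" "b \<in> A" "a < b"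
  then obtain c where c: "b = Suc c" by (cases b) auto
  have cntc: "cnt ?S c = cnt ?S b + of_bool (b \<in> ?S)" using cnt_Suc[of ?S c] c by simp
  have large: "length lam < position t ?S d" if "d \<notin> ?S" "d \<in> A" for d
  proof (cases "d = 0")
    case True
    then show ?thesis using that assms(2)[of 0] card_strict_partition[OF assms(1)] cnt_0[OF shape_set[OF assms(1)]]
      by (simp add: position_def)
  next
    case False
    then show ?thesis using length_lt_gap[OF assms(1), of d] that by (simp add: position_def)
  qed
  have small: "position t ?S d \<le> length lam" if "d \<in> ?S" for d
    using cnt_less_length[OF assms(1) that] that by (simp add: position_def)
  show "position t ?S a \<noteq> position t ?S b"
  proof (cases "a \<in> ?S")
    case a: True
    show ?thesis
    proof (cases "b \<in> ?S")
      case True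
      have "cnt ?S c \<le> cnt ?S a" using ab c by (intro cnt_antimono) auto
      then show ?thesis using a True cntc by (simp add: position_def)
    next
      case False
      then show ?thesis using large[of b] small[OF a] ab by auto
    qed
  next
    case a: False
    show ?thesis
    proof (cases "b \<in> ?S")
      case True
      then show ?thesis using large[OF a ab(1)] small by fastforce
    next
      case False
      have "cnt ?S a \<le> cnt ?S c + (c - a)" using cnt_slope[of ?S a "c - a"] ab c by simp
      then show ?thesis using a False cntc ab c by (simp add: position_def)
    qed
  qed
qed

section \<open>Index sets as images of disagreements\<close>

lemma image_nat_iff:
  fixes D :: "nat set"
  shows "k \<in> f ` D \<longleftrightarrow> 0 \<in> D \<and> k = f 0 \<or> (\<exists>a>0. a \<in> D \<and> k = f a)"
proof
  assume "k \<in> f ` D"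
  then obtain a where "a \<in> D" "k = f a" by blast
  then show "0 \<in> D \<and> k = f 0 \<or> (\<exists>a>0. a \<in> D \<and> k = f a)" by (cases "a = 0") auto
qed blast

lemma ex_position_iff:
  assumes "shape S"
  shows "(\<exists>a>0. a \<in> disagree t S M \<and> k = position t S a) \<longleftrightarrow>
    (\<exists>a\<in>S. a \<notin> M \<and> k = Suc (cnt S a)) \<or> (\<exists>a>0. a \<notin> S \<and> a \<in> M \<and> k = a + cnt S a + of_bool t)"
proof -
  have "a \<in> disagree t S M \<and> k = position t S a \<longleftrightarrow>
      a \<in> S \<and> a \<notin> M \<and> k = Suc (cnt S a) \<or> a \<notin> S \<and> a \<in> M \<and> k = a + cnt S a + of_bool t"
    if "a > 0" for a
    using that by (cases "a \<in> S") (auto simp: pos_disagree position_def)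
  moreover have "a > 0" if "a \<in> S" for a using that assms by (metis gr0I shape_def)
  ultimately show ?thesis by blast
qed

lemma sum_W_B:
  assumes lam: "strict_partition lam" and mu: "strict_partition mu"
  shows "(\<Sum>k\<in>W_B mu lam. x k) = chevalley_factor False x (set lam) (set mu)"
proof -
  let ?D = "disagree False (set lam) (set mu)"
  have zero: "0 \<notin> ?D" "0 \<notin> set lam" "0 \<notin> set mu" using shape_set[OF lam] shape_set[OF mu] zero_disagree
    by (auto simp: shape_def)
  have "W_B mu lam = position False (set lam) ` ?D"
  proof (rule set_eqI)
    fix k
    have "k \<in> W_B mu lam \<longleftrightarrow> (\<exists>a\<in>set lam. a \<notin> set mu \<and> k = Suc (cnt (set lam) a)) \<or>
        (\<exists>a>0. a \<notin> set lam \<and> a \<in> set mu \<and> k = a + cnt (set lam) a)"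
      unfolding W_B_def Un_iff mem_Collect_eq row_condition_iff[OF lam mu]
      using column_condition_iff[OF lam mu, of k] length_lt_gap[OF lam] by (auto simp: Suc_le_eq)
    also have "\<dots> \<longleftrightarrow> k \<in> position False (set lam) ` ?D"
      using ex_position_iff[OF shape_set[OF lam], of False "set mu" k] zero(1)
      unfolding image_nat_iff by simp
    finally show "k \<in> W_B mu lam \<longleftrightarrow> k \<in> position False (set lam) ` ?D" .
  qed
  moreover have "inj_on (position False (set lam)) ?D"
    using zero by (intro inj_position[OF lam]) (auto intro: gr0I)
  ultimately show ?thesis by (simp add: chevalley_factor_def sum.reindex)
qed

lemma sum_W_D:
  assumes lam: "strict_partition lam" and mu: "strict_partition mu"
  shows "(\<Sum>k\<in>W_D mu lam. x k) = chevalley_factor True x (set lam) (set mu)"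
proof -
  let ?D = "disagree True (set lam) (set mu)"
  have zero: "0 \<notin> set lam" "0 \<notin> set mu" using shape_set[OF lam] shape_set[OF mu] by (auto simp: shape_def)
  \<comment> \<open>The parity condition is the disagreement at 0, whose position is
    \<open>length lam + 1\<close>.\<close>
  have zero_D: "0 \<in> ?D \<longleftrightarrow> odd (int (length lam) - int (length mu))"
    using zero_disagree[OF shape_set[OF lam] shape_set[OF mu], of True]
    by (simp add: card_strict_partition lam mu)
  have "W_D mu lam = position True (set lam) ` ?D"
  proof (rule set_eqI)
    fix k
    let ?R = "\<exists>a\<in>set lam. a \<notin> set mu \<and> k = Suc (cnt (set lam) a)"
    let ?C = "\<exists>a>0. a \<notin> set lam \<and> a \<in> set mu \<and> k = a + cnt (set lam) a + 1"
    \<comment> \<open>Columns of type D are shifted by one, so index \<open>k\<close> belongs to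
      column \<open>k - 1\<close> of the type B diagram.\<close>
    have col: "length lam + 2 \<le> k \<and>
         (\<forall>i\<ge>1. int (col_len lam (k - 1)) - int (k - 1) \<noteq> int (col_len mu i) - int i) \<longleftrightarrow> ?C"
    proof (cases "length lam + 2 \<le> k")
      case True
      then have k: "length lam < k - 1" "k = Suc (k - 1)" by auto
      have "?C \<longleftrightarrow> (\<exists>a>0. a \<notin> set lam \<and> a \<in> set mu \<and> k - 1 = a + cnt (set lam) a)" 
        using k by (metis Suc_eq_plus1 diff_Suc_1)
      then show ?thesis using True column_condition_iff[OF lam mu k(1)] by blast
    next
      case False
      have "length lam + 2 \<le> a + cnt (set lam) a + 1" if "a > 0" "a \<notin> set lam" for a
        using length_lt_gap[OF lam that] by simp
      then show ?thesis using False by metis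
    qed
    have "k \<in> W_D mu lam \<longleftrightarrow> ?R \<or> (k = length lam + 1 \<and> 0 \<in> ?D) \<or> ?C"
      unfolding W_D_def Un_iff mem_Collect_eq row_condition_iff[OF lam mu] col zero_D by blast
    also have "\<dots> \<longleftrightarrow> k \<in> position True (set lam) ` ?D"
    proof -
      have "k \<in> position True (set lam) ` ?D \<longleftrightarrow>
          (0 \<in> ?D \<and> k = position True (set lam) 0) \<or> (\<exists>a>0. a \<in> ?D \<and> k = position True (set lam) a)"
        by (rule image_nat_iff)
      moreover have "position True (set lam) 0 = length lam + 1"
        using zero cnt_0[OF shape_set[OF lam]] by (simp add: position_def card_strict_partition lam)
      moreover have "(\<exists>a>0. a \<in> ?D \<and> k = position True (set lam) a) \<longleftrightarrow> ?R \<or> ?C"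
        using ex_position_iff[OF shape_set[OF lam], of True "set mu" k] by simp
      ultimately show ?thesis by auto
    qed
    finally show "k \<in> W_D mu lam \<longleftrightarrow> k \<in> position True (set lam) ` ?D" .
  qed
  moreover have "inj_on (position True (set lam)) ?D" by (rule inj_position[OF lam]) simp
  ultimately show ?thesis by (simp add: chevalley_factor_def sum.reindex)
qed

theorem theorem5:
  fixes lam mu :: "nat list"
  assumes "strict_partition lam" and "strict_partition mu"
  shows "((\<Sum>k\<in>W_B mu lam. Xvar k) * (\<Sum>D\<in>excited_B lam mu. weight_B D) =
           (\<Sum>nu | strict_partition nu \<and> covered_by mu nu \<and> subshape nu lam.
              \<Sum>D\<in>excited_B lam nu. weight_B D)) \<and>
         ((\<Sum>k\<in>W_D mu lam. Xvar k) * (\<Sum>D\<in>excited_D lam mu. weight_D D) =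
           (\<Sum>nu | strict_partition nu \<and> covered_by mu nu \<and> subshape nu lam.
              \<Sum>D\<in>excited_D lam nu. weight_D D))"
proof -
  obtain w where w: "reading w (set lam)" using ex_reading[OF shape_set[OF assms(1)]] by blast
  \<comment> \<open>The flag \<open>t\<close> stays schematic, so this one fact serves both
    types.\<close>
  note chev = chevalley_formula[OF w shape_set[OF assms(2)], folded sum_covers[OF assms w]]
  show ?thesis
    unfolding sum_W_B[OF assms] sum_W_D[OF assms] excited_sum_B[OF assms w] excited_sum_D[OF assms w] chev
    by (intro conjI sum.cong refl) (simp_all add: excited_sum_B[OF assms(1) _ w] excited_sum_D[OF assms(1) _ w])
qed

end
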